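(* Let $C$ be a nonempty closed convex subset of a complete uniformly convex partially ordered hyperbolic space $(E,\rho,\leq)$ with monotone modulus of uniform convexity, and let $T:C\to C$ be a monotone generalized $\alpha$-nonexpansive mapping. Let $\{a_n\},\{b_n\},\{c_n\}\subset(0,1)$, let $x_1\in C$, and let $\{x_n\}_{n\in\mathbf{N}}$ be defined by $$z_n=(1-c_n)x_n\oplus c_nTx_n,\quad y_n=(1-b_n)z_n\oplus b_nTz_n,\quad x_{n+1}=(1-a_n)Tz_n\oplus a_nTy_n,\qquad n\in\mathbf{N}.$$ Let $F(T)$ be the set of fixed points of $T$ in $C$. Assume that $F(T)\neq\emptyset$ and that either (i) $x_1\leq Tx_1$ and $x_1\leq p$ for every $p\in F(T)$, or (ii) $Tx_1\leq x_1$ and $p\leq x_1$ for every $p\in F(T)$. Then $\{x_n\}$ converges (in the metric $\rho$) to a fixed point of $T$ if and only if $\liminf_{n\to\infty}d(x_n,F(T))=0$, where $d(x_n,F(T))=\inf\{\rho(x_n,p):p\in F(T)\}$.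
   Context: A hyperbolic metric space (hyperbolic space) is a metric space $(E,\rho)$ with a mapping $H:E\times E\times[0,1]\to E$, written $H(u,v,\beta)=(1-\beta)u\oplus\beta v$, such that for all $u,v,w,z\in E$ and $\beta,\gamma\in[0,1]$: (1) $\rho(z,H(u,v,\beta))\leq(1-\beta)\rho(z,u)+\beta\rho(z,v)$; (2) $\rho(H(u,v,\beta),H(u,v,\gamma))=|\beta-\gamma|\rho(u,v)$; (3) $H(u,v,\beta)=H(v,u,1-\beta)$; (4) $\rho(H(u,z,\beta),H(v,w,\beta))\leq(1-\beta)\rho(u,v)+\beta\rho(z,w)$. A subset $Y\subset E$ is convex if $(1-\beta)u\oplus\beta v\in Y$ for all $u,v\in Y$, $\beta\in[0,1]$. A partially ordered hyperbolic space $(E,\rho,\leq)$ is a hyperbolic space with a partial order $\leq$; throughout it is assumed that all order intervals $[a,\to)=\{u\in E: a\leq u\}$ and $(\leftarrow,b]=\{u\in E:u\leq b\}$ ($a,b\in E$) are closed and convex. For $r>0$, $\varepsilon\in(0,2]$ put $\delta(r,\varepsilon)=\inf\{1-\frac1r\rho(\frac12u\oplus\frac12v,a): a,u,v\in E,\ \rho(u,a)\leq r,\ \rho(v,a)\leq r,\ \rho(u,v)\geq r\varepsilon\}$. $E$ is uniformly convex if $\delta(r,\varepsilon)>0$ for all $r>0$, $\varepsilon\in(0,2]$; $\delta$ is called the modulus of uniform convexity, and it is monotone if it decreases (is nonincreasing) in $r$ for each fixed $\varepsilon$. A mapping $T:C\to C$ is monotone if $Tx\leq Ty$ whenever $x,y\in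 C$, $x\leq y$. It is monotone generalized $\alpha$-nonexpansive if it is monotone and there is $\alpha\in[0,1)$ such that for all $x,y\in C$ with $x\leq y$: $\frac12\rho(x,Tx)\leq\rho(x,y)$ implies $\rho(Tx,Ty)\leq\alpha\rho(Tx,y)+\alpha\rho(x,Ty)+(1-2\alpha)\rho(x,y)$. *)

theory Defs
  imports "HOL-Analysis.Analysis"
begin

text \<open>
  The space \<open>E\<close> is the carrier of the type \<open>'a\<close>. The value \<open>H u v \<beta>\<close> stands for
  \<open>(1 - \<beta>)u \<oplus> \<beta>v\<close> and is meaningful only for \<open>\<beta> \<in> [0,1]\<close>.
\<close>

definition hyperbolic_space :: "('a::metric_space \<Rightarrow> 'a \<Rightarrow> real \<Rightarrow> 'a) \<Rightarrow> bool" where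
  "hyperbolic_space H \<longleftrightarrow>
     (\<forall>u v z. \<forall>\<beta>\<in>{0..1}.
        dist z (H u v \<beta>) \<le> (1 - \<beta>) * dist z u + \<beta> * dist z v) \<and>
     (\<forall>u v. \<forall>\<beta>\<in>{0..1}. \<forall>\<gamma>\<in>{0..1}.
        dist (H u v \<beta>) (H u v \<gamma>) = \<bar>\<beta> - \<gamma>\<bar> * dist u v) \<and>
     (\<forall>u v. \<forall>\<beta>\<in>{0..1}. H u v \<beta> = H v u (1 - \<beta>)) \<and>
     (\<forall>u v w z. \<forall>\<beta>\<in>{0..1}.
        dist (H u z \<beta>) (H v w \<beta>) \<le> (1 - \<beta>) * dist u v + \<beta> * dist z w)"

definition hconvex :: "('a \<Rightarrow> 'a \<Rightarrow> real \<Rightarrow> 'a) \<Rightarrow> 'a set \<Rightarrow> bool" where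
  "hconvex H Y \<longleftrightarrow> (\<forall>u\<in>Y. \<forall>v\<in>Y. \<forall>\<beta>\<in>{0..1}. H u v \<beta> \<in> Y)"

text \<open>The order of class \<open>order\<close> is related to the metric only through its order intervals.\<close>

definition po_hyperbolic_space ::
    "('a::{metric_space,order} \<Rightarrow> 'a \<Rightarrow> real \<Rightarrow> 'a) \<Rightarrow> bool" where
  "po_hyperbolic_space H \<longleftrightarrow>
     hyperbolic_space H \<and>
     (\<forall>a. closed {a..} \<and> hconvex H {a..}) \<and>
     (\<forall>b. closed {..b} \<and> hconvex H {..b})"

text \<open>
  The modulus is \<open>ereal\<close>-valued so that the infimum over an empty set of triples (for
  example, when no two points are at distance at least \<open>r * \<epsilon>\<close>) is \<open>\<infinity>\<close>.
\<close>

definition uc_modulus ::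
    "('a::metric_space \<Rightarrow> 'a \<Rightarrow> real \<Rightarrow> 'a) \<Rightarrow> real \<Rightarrow> real \<Rightarrow> ereal" where
  "uc_modulus H r \<epsilon> =
     Inf {ereal (1 - (1 / r) * dist (H u v (1 / 2)) a) | a u v.
            dist u a \<le> r \<and> dist v a \<le> r \<and> dist u v \<ge> r * \<epsilon>}"

definition uniformly_convex :: "('a::metric_space \<Rightarrow> 'a \<Rightarrow> real \<Rightarrow> 'a) \<Rightarrow> bool" where
  "uniformly_convex H \<longleftrightarrow> (\<forall>r>0. \<forall>\<epsilon>\<in>{0<..2}. uc_modulus H r \<epsilon> > 0)"

text \<open>
  Nonincreasing in \<open>r\<close>, wherever the modulus is the infimum of a nonempty set. Without the
  guard no bounded space with more than one point could have a monotone modulus, since there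
  the modulus is \<open>\<infinity>\<close> for large \<open>r\<close>; if the set is never empty, the guard has no effect.
\<close>

definition monotone_modulus :: "('a::metric_space \<Rightarrow> 'a \<Rightarrow> real \<Rightarrow> 'a) \<Rightarrow> bool" where
  "monotone_modulus H \<longleftrightarrow>
     (\<forall>\<epsilon>\<in>{0<..2}. \<forall>r s. 0 < r \<and> r \<le> s \<and> uc_modulus H s \<epsilon> < \<infinity>
        \<longrightarrow> uc_modulus H s \<epsilon> \<le> uc_modulus H r \<epsilon>)"

definition monotone_gen_alpha_nonexpansive ::
    "'a::{metric_space,order} set \<Rightarrow> ('a \<Rightarrow> 'a) \<Rightarrow> bool" where
  "monotone_gen_alpha_nonexpansive C T \<longleftrightarrow>
     mono_on C T \<and>
     (\<exists>\<alpha>. 0 \<le> \<alpha> \<and> \<alpha> < 1 \<and>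
        (\<forall>x\<in>C. \<forall>y\<in>C. x \<le> y \<longrightarrow> (1 / 2) * dist x (T x) \<le> dist x y \<longrightarrow>
           dist (T x) (T y) \<le>
             \<alpha> * dist (T x) y + \<alpha> * dist x (T y) + (1 - 2 * \<alpha>) * dist x y))"

definition fixed_points :: "'a set \<Rightarrow> ('a \<Rightarrow> 'a) \<Rightarrow> 'a set" where
  "fixed_points C T = {p \<in> C. T p = p}"

end

theory Submission
  imports Defs
begin

text \<open>
  The classical argument for such criteria is that the distances from the iterates to each
  fixed point decrease. Then an iterate close to a fixed point is followed only by close ones, the
  sequence is Cauchy, and its limit is fixed. If the iteration starts above all fixed points,
  this argument applies: the defining inequality can be used for a fixed point \<open>p\<close> on the left,
  where its premise is trivial (lemma \<open>convergence_from_above\<close>).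

  If the iteration starts below the fixed points, all points lie on increasing chains
  \<open>x n \<le> z n \<le> y n \<le> x (n + 1)\<close> below every fixed point, and the inequality for a point \<open>v\<close> and
  a fixed point \<open>p\<close> is available only if the displacement \<open>D v = dist v (T v)\<close> is at most
  \<open>2 * dist v p\<close>. Otherwise \<open>v\<close> is called bad for \<open>p\<close>, and \<open>T v\<close> may be farther from \<open>p\<close> than \<open>v\<close>.
  If bad points cease to occur, the classical argument applies (lemma \<open>convergence_if_good\<close>). If
  one bad point exists, it confines the iteration, as follows.

  Uniform convexity with monotone modulus gives approximate uniqueness of points on geodesics, nonempty
  intersections of decreasing bounded closed convex sets, and asymptotic centres. It follows that
  every iterate starts an increasing sequence of points with displacements tending to zero
  (\<open>D_reg_tendsto_0\<close>), that there is a least fixed point \<open>e\<close>, and that the points of a segment from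
  an almost fixed point to a point near a fixed point are almost fixed (\<open>almost_fixed_on_segment\<close>). If
  \<open>v\<close> is bad for \<open>p\<close>, almost fixed points between \<open>T v\<close> and \<open>p\<close> cannot leave the ball of radius
  \<open>D v / 2\<close> around \<open>v\<close>: on its boundary they would be close to the midpoint of \<open>v\<close> and \<open>T v\<close>, which
  is not above \<open>T v\<close>. This bounds the iterates that are close to fixed points
  (\<open>near_fixed_points_bounded\<close>). These iterates then have small displacements and are close to \<open>e\<close>
  (\<open>approach_to_least_fixed_point\<close>). So a subsequence converges to \<open>e\<close>, and it remains to
  exclude that the iterates move away from \<open>e\<close> in between.

  For positive \<open>\<alpha>\<close> they cannot leave a small ball around \<open>e\<close>. A point near the boundary of the ball is
  close to an end of the segment on which it lies, and following this back for two steps shows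
  that it is close to the image of an earlier point. The defining inequality then makes its displacement
  smaller than the diameter of the ball by a factor below one, so it is not bad for \<open>e\<close>, and its
  image stays in the ball (\<open>trapping\<close>).

  For \<open>\<alpha> = 0\<close> this factor is one. Instead, a point \<open>v\<close> that is bad for \<open>e\<close> confines all late points to the ball of
  radius \<open>D v / 2\<close> around \<open>v\<close>, because sets of late points shrink to \<open>e\<close> in a weak
  sense (\<open>late_points_near_bad_point\<close>). If bad points occur again and again, two of them with nearly
  minimal displacement can be compared; they would both be close to \<open>e\<close> and to the midpoint of
  the later one and its image, so the minimal displacement is zero
  (\<open>bad_point_with_small_displacement\<close>). Therefore late points are close to \<open>e\<close>.
\<close>

section \<open>Uniformly convex hyperbolic spaces\<close>

locale uc_hyperbolic =
  fixes H :: "'a::metric_space \<Rightarrow> 'a \<Rightarrow> real \<Rightarrow> 'a"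
  assumes hyp: "hyperbolic_space H"
    and uc: "uniformly_convex H"
    and mono_mod: "monotone_modulus H"
begin

lemma dist_H_le:
  assumes "0 \<le> t" "t \<le> 1"
  shows "dist z (H u v t) \<le> (1 - t) * dist z u + t * dist z v"
  using hyp[unfolded hyperbolic_space_def, THEN conjunct1] assms by simp

lemma dist_H_H:
  assumes "0 \<le> s" "s \<le> 1" "0 \<le> t" "t \<le> 1"
  shows "dist (H u v s) (H u v t) = \<bar>s - t\<bar> * dist u v"
  using hyp[unfolded hyperbolic_space_def, THEN conjunct2, THEN conjunct1] assms by simp

lemma H_commute:
  assumes "0 \<le> t" "t \<le> 1"
  shows "H u v t = H v u (1 - t)"
  using hyp[unfolded hyperbolic_space_def, THEN conjunct2, THEN conjunct2, THEN conjunct1,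
      rule_format, of t u v] assms by simp

lemma dist_H_ball:
  assumes "0 \<le> t" "t \<le> 1" "dist z u \<le> r" "dist z v \<le> r"
  shows "dist z (H u v t) \<le> r"
proof -
  have "dist z (H u v t) \<le> (1 - t) * r + t * r"
    using dist_H_le[OF assms(1,2), of z u v] mult_left_mono[OF assms(3), of "1 - t"]
      mult_left_mono[OF assms(4), of t] assms(1,2) by linarith
  then show ?thesis by (simp add: algebra_simps)
qed

lemma dist_H_left:
  assumes "0 \<le> t" "t \<le> 1"
  shows "dist u (H u v t) = t * dist u v"
    and "dist v (H u v t) = (1 - t) * dist u v"
proof -
  have 1: "dist u (H u v t) \<le> t * dist u v"
    using dist_H_le[OF assms, of u u v] by simp
  have 2: "dist v (H u v t) \<le> (1 - t) * dist u v"
    using dist_H_le[OF assms, of v u v] by (simp add: dist_commute)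
  have 3: "dist u v \<le> dist u (H u v t) + dist v (H u v t)"
    by (metis dist_triangle2)
  have 4: "(1 - t) * dist u v + t * dist u v = dist u v" by (simp add: algebra_simps)
  show "dist u (H u v t) = t * dist u v" using 1 2 3 4 by linarith
  show "dist v (H u v t) = (1 - t) * dist u v" using 1 2 3 4 by linarith
qed

lemma H_0 [simp]: "H u v 0 = u"
  using dist_H_left(1)[of 0 u v] by simp

lemma H_1 [simp]: "H u v 1 = v"
  using dist_H_left(2)[of 1 v u] dist_H_left(2)[of 1 u v] by simp

lemma continuous_on_H: "continuous_on {0..1} (H u v)"
proof (rule continuous_onI)
  fix t e :: real assume t: "t \<in> {0..1}" and e: "e > 0"
  define d where "d = e / (dist u v + 1)"
  have d: "d > 0" using e by (simp add: d_def add_nonneg_pos)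
  have "dist (H u v s) (H u v t) \<le> e" if "s \<in> {0..1}" "dist s t < d" for s
  proof -
    have "dist (H u v s) (H u v t) = \<bar>s - t\<bar> * dist u v" using dist_H_H that t by simp
    also have "\<dots> \<le> d * (dist u v + 1)"
      using that(2) d by (intro mult_mono) (auto simp: dist_real_def)
    also have "\<dots> = e" using zero_le_dist[of u v] unfolding d_def by (smt (verit) nonzero_divide_eq_eq)
    finally show ?thesis .
  qed
  then show "\<exists>d>0. \<forall>s\<in>{0..1}. dist s t < d \<longrightarrow> dist (H u v s) (H u v t) \<le> e" using d by blast
qed

lemma segment_point_at_dist:
  assumes "dist v u < r" "r \<le> dist v w"
  obtains s where "0 \<le> s" "s \<le> 1" "dist v (H u w s) = r"
proof -
  have "continuous_on {0..1} (\<lambda>s. dist v (H u w s))"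
    by (intro continuous_intros continuous_on_H)
  then have "\<exists>s. 0 \<le> s \<and> s \<le> 1 \<and> dist v (H u w s) = r"
    using assms by (intro IVT') auto
  then show ?thesis using that by blast
qed

text \<open>
  The convexity modulus in additive form. It is stated for all radii below a bound \<^term>\<open>R\<close>,
  and monotonicity of the modulus is what makes the gain independent of the radius. The additive
  form also covers small radii, for which two points at distance \<^term>\<open>\<eta>\<close> do not exist.
\<close>

lemma midpoint_gain:
  fixes R \<eta> :: real
  assumes \<eta>: "0 < \<eta>"
  shows "\<exists>\<delta>>0. \<forall>a u v r. r \<le> R \<longrightarrow> dist a u \<le> r \<longrightarrow> dist a v \<le> r \<longrightarrow> \<eta> \<le> dist u v \<longrightarrow>
           dist a (H u v (1/2)) \<le> r - \<delta>"
proof (cases "\<eta> \<le> 2 * R")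
  case False
  have "dist a (H u v (1/2)) \<le> r - 1"
    if "r \<le> R" "dist a u \<le> r" "dist a v \<le> r" "\<eta> \<le> dist u v" for a u v r
    using dist_triangle3[of u v a] that False by linarith
  then show ?thesis by (intro exI[of _ 1]) simp
next
  case True
  define \<epsilon> where "\<epsilon> = \<eta> / R"
  have R: "R > 0" using True \<eta> by linarith
  have \<epsilon>: "\<epsilon> \<in> {0<..2}" using True R \<eta> by (simp add: \<epsilon>_def field_simps)
  have R\<epsilon>: "R * \<epsilon> = \<eta>" using R by (simp add: \<epsilon>_def)
  define M where "M = uc_modulus H"
  have pos: "0 < M R \<epsilon>" using uc R \<epsilon> unfolding uniformly_convex_def M_def by blast
  obtain c :: real where c: "0 < c" "ereal c \<le> M R \<epsilon>"
  proof (cases "M R \<epsilon>")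
    case (real x)
    then show ?thesis using pos that[of x] by simp
  next
    case PInf then show ?thesis using that[of 1] by simp
  next
    case MInf then show ?thesis using pos by simp
  qed
  have mem: "M r \<epsilon> \<le> ereal (1 - (1 / r) * dist (H u v (1/2)) a)"
    if "dist u a \<le> r" "dist v a \<le> r" "r * \<epsilon> \<le> dist u v" for a u v r
    unfolding M_def uc_modulus_def using that by (intro Inf_lower) blast
  have "dist a (H u v (1/2)) \<le> r - c * \<eta> / 2"
    if h: "r \<le> R" "dist a u \<le> r" "dist a v \<le> r" "\<eta> \<le> dist u v" for a u v r
  proof -
    have r: "\<eta> / 2 \<le> r" using dist_triangle3[of u v a] h by linarith
    then have rpos: "r > 0" using \<eta> by linarith
    have "r * \<epsilon> \<le> R * \<epsilon>" using h \<epsilon> by (intro mult_right_mono) auto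
    then have sep: "r * \<epsilon> \<le> dist u v" "R * \<epsilon> \<le> dist u v" using R\<epsilon> h by linarith+
    have "M R \<epsilon> \<le> ereal (1 - (1 / R) * dist (H u v (1/2)) a)"
      using h sep by (intro mem) (auto simp: dist_commute)
    then have fin: "M R \<epsilon> < \<infinity>" by auto
    then have "M R \<epsilon> \<le> M r \<epsilon>"
      using mono_mod \<epsilon> rpos h(1) unfolding monotone_modulus_def M_def by blast
    also have "M r \<epsilon> \<le> ereal (1 - (1 / r) * dist (H u v (1/2)) a)"
      using h sep by (intro mem) (auto simp: dist_commute)
    finally have "ereal c \<le> ereal (1 - (1 / r) * dist (H u v (1/2)) a)" using c(2) order_trans by blast
    then have "c \<le> 1 - dist a (H u v (1/2)) / r" by (simp add: dist_commute)
    then have "c * r \<le> r - dist a (H u v (1/2))" using rpos by (simp add: field_simps)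
    moreover have "c * (\<eta> / 2) \<le> c * r" using r c by (intro mult_left_mono) auto
    ultimately show ?thesis by simp
  qed
  moreover have "0 < c * \<eta> / 2" using c \<eta> by simp
  ultimately show ?thesis by blast
qed

text \<open>
  The midpoint of two points of nearly the same position between \<^term>\<open>u\<close> and \<^term>\<open>v\<close> is not
  farther from \<^term>\<open>v\<close> than they are, and if they are far apart it is closer to \<^term>\<open>u\<close> by a fixed
  amount; this contradicts the triangle inequality. The convexity is used at \<^term>\<open>u\<close> only, so the
  distance to \<^term>\<open>v\<close> may be arbitrarily large.
\<close>

lemma geodesic_nearly_unique:
  fixes R \<eta> :: real
  assumes \<eta>: "0 < \<eta>"
  shows "\<exists>\<delta>>0. \<forall>(u::'a) v p q s t. s \<le> R \<longrightarrow> dist u p \<le> s \<longrightarrow> dist u q \<le> s \<longrightarrow> dist v p \<le> t \<longrightarrow>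
           dist v q \<le> t \<longrightarrow> s + t \<le> dist u v + \<delta> \<longrightarrow> dist p q < \<eta>"
proof -
  obtain \<delta> where \<delta>: "0 < \<delta>"
    "\<And>a u v r. r \<le> R \<Longrightarrow> dist a u \<le> r \<Longrightarrow> dist a v \<le> r \<Longrightarrow> \<eta> \<le> dist u v \<Longrightarrow> dist a (H u v (1/2)) \<le> r - \<delta>"
    using midpoint_gain[OF \<eta>, of R] by blast
  have "dist p q < \<eta>"
    if h: "s \<le> R" "dist u p \<le> s" "dist u q \<le> s" "dist v p \<le> t" "dist v q \<le> t"
      "s + t \<le> dist u v + \<delta> / 2" for u v p q :: 'a and s t
  proof (rule ccontr)
    assume "\<not> dist p q < \<eta>"
    then have 1: "dist u (H p q (1/2)) \<le> s - \<delta>" using h by (intro \<delta>(2)) auto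
    have 2: "dist v (H p q (1/2)) \<le> t" using h by (intro dist_H_ball) auto
    have "dist u v \<le> dist u (H p q (1/2)) + dist v (H p q (1/2))"
      by (metis dist_triangle2)
    then show False using 1 2 h(6) \<delta>(1) by linarith
  qed
  moreover have "0 < \<delta> / 2" using \<delta>(1) by simp
  ultimately show ?thesis by blast
qed

lemma geodesic_unique:
  fixes u v p q :: 'a
  assumes "dist u p \<le> s" "dist u q \<le> s" "dist v p \<le> t" "dist v q \<le> t" "s + t \<le> dist u v"
  shows "p = q"
proof (rule ccontr)
  assume "p \<noteq> q"
  then have "0 < dist p q" by simp
  from geodesic_nearly_unique[OF this, of s] obtain \<delta> where \<delta>: "0 < \<delta>"
    "\<And>(u::'a) v p' q' s' t. s' \<le> s \<Longrightarrow> dist u p' \<le> s' \<Longrightarrow> dist u q' \<le> s' \<Longrightarrow> dist v p' \<le> t \<Longrightarrow>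
       dist v q' \<le> t \<Longrightarrow> s' + t \<le> dist u v + \<delta> \<Longrightarrow> dist p' q' < dist p q"
    by blast
  have "dist p q < dist p q"
    by (rule \<delta>(2)[of s u p q v t]) (use assms \<delta>(1) in linarith)+
  then show False by simp
qed

lemma H_initial_segment:
  assumes "0 \<le> s" "s \<le> 1" "0 \<le> t" "t \<le> 1"
  shows "H u (H u v s) t = H u v (t * s)"
proof (rule geodesic_unique[of u _ "t * s * dist u v" _ v "(1 - t * s) * dist u v"])
  have ts: "0 \<le> t * s" "t * s \<le> 1" using assms by (auto simp: mult_le_one)
  show "dist u (H u (H u v s) t) \<le> t * s * dist u v"
    using assms by (simp add: dist_H_left mult_ac)
  show "dist u (H u v (t * s)) \<le> t * s * dist u v" using ts by (simp add: dist_H_left)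
  show "dist v (H u v (t * s)) \<le> (1 - t * s) * dist u v" using ts by (simp add: dist_H_left)
  have "dist v (H u (H u v s) t) \<le> (1 - t) * dist v u + t * dist v (H u v s)"
    using assms by (intro dist_H_le) auto
  also have "\<dots> = (1 - t * s) * dist u v"
    using assms by (simp add: dist_H_left algebra_simps dist_commute)
  finally show "dist v (H u (H u v s) t) \<le> (1 - t * s) * dist u v" .
  show "t * s * dist u v + (1 - t * s) * dist u v \<le> dist u v"
    by (simp add: left_diff_distrib)
qed

lemma H_final_segment:
  assumes "0 \<le> s" "s \<le> t" "t \<le> 1"
  obtains r where "0 \<le> r" "r \<le> 1" "H u v t = H (H u v s) v r"
proof (cases "s = 1")
  case True
  then have "H u v t = H (H u v s) v 0" using assms by simp
  then show ?thesis by (intro that[of 0]) auto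
next
  case False
  define r where "r = (1 - t) / (1 - s)"
  have r: "0 \<le> r" "r \<le> 1" "r * (1 - s) = 1 - t" using assms False by (auto simp: r_def field_simps)
  have "H u v t = H v u (1 - t)" using assms by (intro H_commute) auto
  also have "\<dots> = H v (H v u (1 - s)) r" using H_initial_segment[of "1 - s" r v u] r assms by simp
  also have "\<dots> = H v (H u v s) r" using H_commute[of s u v] assms by simp
  also have "\<dots> = H (H u v s) v (1 - r)" using H_commute[of r v "H u v s"] r by simp
  finally have eq: "H u v t = H (H u v s) v (1 - r)" .
  show ?thesis by (rule that[OF _ _ eq]) (use r in auto)
qed

text \<open>
  A point of a segment lies between the midpoint and one end, and by convexity of the distance to
  \<^term>\<open>p\<close> it inherits a part of the gain at the midpoint. The part is small only near that end.
  The end in question is then itself nearly at distance \<^term>\<open>R\<close>, with at most twice the defect.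
\<close>

lemma extremal_near_endpoint:
  fixes R \<eta> :: real
  assumes \<eta>: "0 < \<eta>"
  shows "\<exists>\<delta>>0. \<forall>p u v t d. dist p u \<le> R \<longrightarrow> dist p v \<le> R \<longrightarrow> 0 \<le> t \<longrightarrow> t \<le> 1 \<longrightarrow> d \<le> \<delta> \<longrightarrow> R - d < dist p (H u v t) \<longrightarrow>
      (dist u (H u v t) \<le> \<eta> \<and> R - 2 * d < dist p u) \<or> (dist v (H u v t) \<le> \<eta> \<and> R - 2 * d < dist p v)"
proof -
  obtain \<delta> where \<delta>: "0 < \<delta>"
    "\<And>a u v r. r \<le> R \<Longrightarrow> dist a u \<le> r \<Longrightarrow> dist a v \<le> r \<Longrightarrow> \<eta> \<le> dist u v \<Longrightarrow> dist a (H u v (1/2)) \<le> r - \<delta>"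
    using midpoint_gain[OF \<eta>, of R] by blast
  define \<delta>' where "\<delta>' = (if R \<le> 0 then 1 else \<delta> * \<eta> / R)"
  have \<delta>': "0 < \<delta>'" using \<delta>(1) \<eta> by (simp add: \<delta>'_def)
  have half: "dist u (H u v t) \<le> \<eta> \<and> R - 2 * d < dist p u"
    if h: "dist p u \<le> R" "dist p v \<le> R" "0 \<le> t" "t \<le> 1/2" "d \<le> \<delta>'" "R - d < dist p (H u v t)" for p u v t d
  proof
    have d: "d > 0" using dist_H_ball[of t p u R v] h by linarith
    have "R - d < (1 - t) * dist p u + t * R"
      using dist_H_le[of t p u v] mult_left_mono[OF h(2), of t] h by linarith
    then have "(1 - t) * (R - dist p u) < d" by (simp add: algebra_simps)
    moreover have "(1/2) * (R - dist p u) \<le> (1 - t) * (R - dist p u)"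
      using h by (intro mult_right_mono) auto
    ultimately have "(1/2) * (R - dist p u) < d" by (rule le_less_trans[rotated])
    then show "R - 2 * d < dist p u" by simp
    show "dist u (H u v t) \<le> \<eta>"
    proof (rule ccontr)
      assume "\<not> dist u (H u v t) \<le> \<eta>"
      then have t: "\<eta> < t * dist u v" using h by (simp add: dist_H_left)
      have uv: "dist u v \<le> 2 * R" using dist_triangle3[of u v p] h by linarith
      have "t * dist u v \<le> 1 * dist u v" using h by (intro mult_right_mono) auto
      then have "\<eta> \<le> dist u v" using t by linarith
      then have m: "dist p (H u v (1/2)) \<le> R - \<delta>" using \<delta>(2)[of R p u v] h by simp
      have R: "R > 0" using uv t \<eta> h zero_le_dist[of u v] \<open>\<eta> \<le> dist u v\<close> by linarith
      have "H u v t = H u (H u v (1/2)) (2 * t)" using H_initial_segment[of "1/2" "2 * t" u v] h by simp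
      then have "dist p (H u v t) \<le> (1 - 2 * t) * dist p u + 2 * t * dist p (H u v (1/2))"
        using dist_H_le[of "2 * t" p u "H u v (1/2)"] h by simp
      also have "\<dots> \<le> (1 - 2 * t) * R + 2 * t * (R - \<delta>)"
        using h m by (intro add_mono mult_left_mono) auto
      also have "\<dots> = R - 2 * t * \<delta>" by (simp add: algebra_simps)
      finally have "2 * t * \<delta> < d" using h by linarith
      moreover have "\<delta> * \<eta> / R \<le> 2 * t * \<delta>"
      proof -
        have "\<eta> \<le> t * (2 * R)" using t uv h mult_left_mono[OF uv, of t] by linarith
        then have "\<delta> * \<eta> \<le> \<delta> * (t * (2 * R))" using \<delta>(1) by (intro mult_left_mono) auto
        then show ?thesis using R by (simp add: field_simps)
      qed
      ultimately show False using h(5) R by (simp add: \<delta>'_def)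
    qed
  qed
  have "(dist u (H u v t) \<le> \<eta> \<and> R - 2 * d < dist p u) \<or> (dist v (H u v t) \<le> \<eta> \<and> R - 2 * d < dist p v)"
    if h: "dist p u \<le> R" "dist p v \<le> R" "0 \<le> t" "t \<le> 1" "d \<le> \<delta>'" "R - d < dist p (H u v t)" for p u v t d
  proof (cases "t \<le> 1/2")
    case True then show ?thesis using half[of p u v t d] h by blast
  next
    case False
    then show ?thesis using half[of p v u "1 - t" d] h H_commute[of t u v] by simp
  qed
  then show ?thesis using \<delta>' by blast
qed

lemma hconvexD:
  "hconvex H A \<Longrightarrow> u \<in> A \<Longrightarrow> v \<in> A \<Longrightarrow> 0 \<le> t \<Longrightarrow> t \<le> 1 \<Longrightarrow> H u v t \<in> A"
  unfolding hconvex_def by auto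

text \<open>
  In a complete uniformly convex space bounded closed convex sets behave like weakly compact ones:
  a decreasing sequence of them has a common point. The points of the sets that are nearly closest
  to a fixed base point form a Cauchy sequence, because a midpoint of two of them would be too close.
\<close>

lemma nested_convex_Int_nonempty:
  fixes A :: "nat \<Rightarrow> 'a set"
  assumes complete: "complete (UNIV :: 'a set)"
    and closed: "\<And>n. closed (A n)" and convex: "\<And>n. hconvex H (A n)"
    and dec: "\<And>n. A (Suc n) \<subseteq> A n"
    and meets: "\<And>n. \<exists>a\<in>A n. dist p a \<le> B"
  obtains q where "\<And>n. q \<in> A n" "dist p q \<le> B"
proof -
  have anti: "A n \<subseteq> A m" if "m \<le> n" for m n
    using lift_Suc_antimono_le[of A] dec that by blast
  define \<rho> where "\<rho> n = Inf (dist p ` A n)" for n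
  have bdd: "bdd_below (dist p ` A n)" for n by (rule bdd_belowI[of _ 0]) auto
  have ne: "A n \<noteq> {}" for n using meets by blast
  have \<rho>_le: "\<rho> n \<le> dist p a" if "a \<in> A n" for n a
    unfolding \<rho>_def using that bdd by (intro cInf_lower) auto
  have \<rho>B: "\<rho> n \<le> B" for n using meets[of n] \<rho>_le by (meson order_trans)
  have inc: "incseq \<rho>"
  proof (rule incseq_SucI)
    fix n show "\<rho> n \<le> \<rho> (Suc n)"
      unfolding \<rho>_def using dec ne bdd by (intro cInf_superset_mono) auto
  qed
  then obtain r where r: "\<rho> \<longlonglongrightarrow> r" "\<And>n. \<rho> n \<le> r"
    using incseq_convergent[of \<rho> B] \<rho>B by auto
  have "r \<le> B" using LIMSEQ_le_const2[OF r(1)] \<rho>B by blast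
  have "\<exists>a\<in>A n. dist p a < \<rho> n + 1 / Suc n" for n
  proof -
    have "Inf (dist p ` A n) < \<rho> n + 1 / Suc n" by (simp add: \<rho>_def)
    then show ?thesis using cInf_lessD[of "dist p ` A n"] ne by blast
  qed
  then obtain a where a: "\<And>n. a n \<in> A n" "\<And>n. dist p (a n) < \<rho> n + 1 / Suc n" by metis
  have "Cauchy a"
  proof (rule metric_CauchyI)
    fix \<eta> :: real assume \<eta>: "0 < \<eta>"
    obtain \<delta> where \<delta>: "0 < \<delta>"
      "\<And>a u v s. s \<le> r + 1 \<Longrightarrow> dist a u \<le> s \<Longrightarrow> dist a v \<le> s \<Longrightarrow> \<eta> \<le> dist u v \<Longrightarrow> dist a (H u v (1/2)) \<le> s - \<delta>"
      using midpoint_gain[OF \<eta>, of "r + 1"] by blast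
    have "(\<lambda>n. \<rho> n - 1 / Suc n) \<longlonglongrightarrow> r - 0"
      by (intro tendsto_diff r LIMSEQ_Suc[OF lim_inverse_n'])
    then have "eventually (\<lambda>n. r - \<delta> < \<rho> n - 1 / Suc n) sequentially"
      using \<delta>(1) by (intro order_tendstoD) auto
    then obtain N where N: "r - \<delta> < \<rho> N - 1 / Suc N" by (auto simp: eventually_sequentially)
    have "dist (a m) (a n) < \<eta>" if mn: "m \<ge> N" "n \<ge> N" for m n
    proof (rule ccontr)
      assume far: "\<not> dist (a m) (a n) < \<eta>"
      have *: "dist p (a k) \<le> r + 1 / Suc N" if "k \<ge> N" for k
      proof -
        have "1 / real (Suc k) \<le> 1 / real (Suc N)" using that by (simp add: field_simps)
        then show ?thesis using a(2)[of k] r(2)[of k] by linarith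
      qed
      have "dist p (H (a m) (a n) (1/2)) \<le> r + 1 / Suc N - \<delta>"
        using * mn far by (intro \<delta>(2)) auto
      moreover have "H (a m) (a n) (1/2) \<in> A N"
        using anti[OF mn(1)] anti[OF mn(2)] a(1) convex by (intro hconvexD) auto
      ultimately show False using \<rho>_le N by fastforce
    qed
    then show "\<exists>M. \<forall>m\<ge>M. \<forall>n\<ge>M. dist (a m) (a n) < \<eta>" by blast
  qed
  then obtain q where q: "a \<longlonglongrightarrow> q" using complete unfolding complete_def by blast
  have "q \<in> A n" for n
  proof (rule closed_sequentially[OF closed, of "\<lambda>k. a (k + n)"])
    show "a (k + n) \<in> A n" for k using a(1) anti[of n "k + n"] by auto
    show "(\<lambda>k. a (k + n)) \<longlonglongrightarrow> q" using q by (rule LIMSEQ_ignore_initial_segment)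
  qed
  moreover have "dist p q \<le> r"
  proof (rule LIMSEQ_le)
    show "(\<lambda>n. dist p (a n)) \<longlonglongrightarrow> dist p q" by (intro tendsto_intros q)
    have "(\<lambda>n. r + 1 / Suc n) \<longlonglongrightarrow> r + 0"
      by (intro tendsto_intros LIMSEQ_Suc[OF lim_inverse_n'])
    then show "(\<lambda>n. r + 1 / Suc n) \<longlonglongrightarrow> r" by simp
    show "\<exists>N. \<forall>n\<ge>N. dist p (a n) \<le> r + 1 / Suc n"
      using a(2) r(2) by (meson add_right_mono less_imp_le order_trans)
  qed
  ultimately show ?thesis using that \<open>r \<le> B\<close> by (meson order_trans)
qed

text \<open>
  The asymptotic centre of a bounded sequence \<^term>\<open>l\<close> relative to a closed convex set \<^term>\<open>S\<close>:
  \<^term>\<open>r\<close> is the smallest asymptotic radius and \<^term>\<open>c\<close> the only point of \<^term>\<open>S\<close> attaining it.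
  Two points that nearly attain the smallest radius are close, because their midpoint has a radius
  that is smaller by a fixed amount if they are far apart.
\<close>

lemma asymptotic_center:
  fixes l :: "nat \<Rightarrow> 'a" and S :: "'a set"
  assumes complete: "complete (UNIV :: 'a set)"
    and S: "closed S" "hconvex H S" and t0: "t0 \<in> S" "\<And>n. dist (l n) t0 \<le> B"
  shows "\<exists>c r. c \<in> S \<and>
    (\<forall>t\<in>S. \<forall>b. eventually (\<lambda>n. dist (l n) t \<le> b) sequentially \<longrightarrow> r \<le> b) \<and>
    (\<forall>b>r. eventually (\<lambda>n. dist (l n) c \<le> b) sequentially) \<and>
    (\<forall>t\<in>S. (\<forall>b>r. eventually (\<lambda>n. dist (l n) t \<le> b) sequentially) \<longrightarrow> t = c)"
proof -
  define P where "P t b \<longleftrightarrow> eventually (\<lambda>n. dist (l n) t \<le> b) sequentially" for t b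
  have P_mono: "P t b'" if "P t b" "b \<le> b'" for t b b'
    using that unfolding P_def by (auto elim: eventually_mono)
  define r where "r = Inf {b. \<exists>t\<in>S. P t b}"
  have nonneg: "0 \<le> b" if Ptb: "P t b" for t b
  proof -
    obtain n where "dist (l n) t \<le> b"
      using eventually_happens'[OF sequentially_bot Ptb[unfolded P_def]] by blast
    then show ?thesis using zero_le_dist[of "l n" t] by linarith
  qed
  have bdd: "bdd_below {b. \<exists>t\<in>S. P t b}" using nonneg by (intro bdd_belowI[of _ 0]) auto
  have ne: "B \<in> {b. \<exists>t\<in>S. P t b}" using t0 by (auto simp: P_def intro!: bexI[of _ t0])
  have r_le: "r \<le> b" if "t \<in> S" "P t b" for t b
    unfolding r_def using that bdd by (intro cInf_lower) auto
  have near: "\<exists>\<epsilon>>0. \<forall>t\<in>S. \<forall>t'\<in>S. P t (r + \<epsilon>) \<longrightarrow> P t' (r + \<epsilon>) \<longrightarrow> dist t t' < \<eta>" if \<eta>: "\<eta> > 0" for \<eta>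
  proof -
    obtain \<delta> where \<delta>: "0 < \<delta>"
      "\<And>a u v s. s \<le> r + 1 \<Longrightarrow> dist a u \<le> s \<Longrightarrow> dist a v \<le> s \<Longrightarrow> \<eta> \<le> dist u v \<Longrightarrow> dist a (H u v (1/2)) \<le> s - \<delta>"
      using midpoint_gain[OF \<eta>, of "r + 1"] by blast
    define \<epsilon> where "\<epsilon> = min 1 (\<delta> / 2)"
    have \<epsilon>: "0 < \<epsilon>" "\<epsilon> \<le> 1" "\<epsilon> < \<delta>" using \<delta>(1) by (auto simp: \<epsilon>_def)
    have "dist t t' < \<eta>" if h: "t \<in> S" "t' \<in> S" "P t (r + \<epsilon>)" "P t' (r + \<epsilon>)" for t t'
    proof (rule ccontr)
      assume far: "\<not> dist t t' < \<eta>"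
      have "P (H t t' (1/2)) (r + \<epsilon> - \<delta>)"
        unfolding P_def
      proof (rule eventually_elim2[OF h(3,4)[unfolded P_def]])
        fix n assume "dist (l n) t \<le> r + \<epsilon>" "dist (l n) t' \<le> r + \<epsilon>"
        then show "dist (l n) (H t t' (1/2)) \<le> r + \<epsilon> - \<delta>"
          using far \<epsilon> by (intro \<delta>(2)) auto
      qed
      moreover have "H t t' (1/2) \<in> S" using S h by (intro hconvexD) auto
      ultimately show False using r_le \<epsilon> by fastforce
    qed
    then show ?thesis using \<epsilon> by blast
  qed
  have "\<exists>t\<in>S. P t (r + 1 / Suc n)" for n
  proof -
    have "Inf {b. \<exists>t\<in>S. P t b} < r + 1 / Suc n" by (simp add: r_def)
    then obtain b where "\<exists>t\<in>S. P t b" "b < r + 1 / Suc n"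
      using cInf_lessD[of "{b. \<exists>t\<in>S. P t b}"] ne by auto
    then show ?thesis using P_mono by (meson less_imp_le)
  qed
  then obtain a where a: "\<And>n. a n \<in> S" "\<And>n. P (a n) (r + 1 / Suc n)" by metis
  have a': "P (a n) (r + \<epsilon>)" if "1 / Suc N < \<epsilon>" "n \<ge> N" for n N \<epsilon>
  proof -
    have "1 / real (Suc n) \<le> 1 / real (Suc N)" using that by (simp add: field_simps)
    then show ?thesis using P_mono[OF a(2)[of n]] that by simp
  qed
  have "Cauchy a"
  proof (rule metric_CauchyI)
    fix \<eta> :: real assume "0 < \<eta>"
    then obtain \<epsilon> where \<epsilon>: "\<epsilon> > 0" "\<forall>t\<in>S. \<forall>t'\<in>S. P t (r + \<epsilon>) \<longrightarrow> P t' (r + \<epsilon>) \<longrightarrow> dist t t' < \<eta>"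
      using near by blast
    then obtain N where "1 / Suc N < \<epsilon>" using nat_approx_posE by metis
    then show "\<exists>M. \<forall>m\<ge>M. \<forall>n\<ge>M. dist (a m) (a n) < \<eta>" using a(1) a' \<epsilon>(2) by blast
  qed
  then obtain c where c: "a \<longlonglongrightarrow> c" using complete unfolding complete_def by blast
  have cS: "c \<in> S" using closed_sequentially[OF S(1), of a] a(1) c by blast
  have c_le: "P c b" if "r < b" for b
  proof -
    define \<epsilon> where "\<epsilon> = (b - r) / 2"
    have \<epsilon>: "\<epsilon> > 0" "r + \<epsilon> + \<epsilon> = b" using that by (auto simp: \<epsilon>_def)
    obtain N where N: "1 / Suc N < \<epsilon>" using nat_approx_posE \<epsilon> by metis
    obtain N' where N': "\<And>n. n \<ge> N' \<Longrightarrow> dist (a n) c < \<epsilon>" using c \<epsilon>(1) unfolding lim_sequentially by blast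
    define n where "n = max N N'"
    have 1: "dist (a n) c < \<epsilon>" using N' by (simp add: n_def)
    have "P (a n) (r + \<epsilon>)" using a' N by (simp add: n_def)
    then show ?thesis
      unfolding P_def
    proof (rule eventually_mono)
      fix m assume "dist (l m) (a n) \<le> r + \<epsilon>"
      then show "dist (l m) c \<le> b" using 1 \<epsilon> dist_triangle[of "l m" c "a n"] by linarith
    qed
  qed
  have uniq: "t = c" if "t \<in> S" "\<And>b. r < b \<Longrightarrow> P t b" for t
  proof (rule ccontr)
    assume "t \<noteq> c"
    then have "0 < dist t c" by simp
    from near[OF this] obtain \<epsilon> where \<epsilon>: "\<epsilon> > 0"
      and imp: "\<forall>t1\<in>S. \<forall>t2\<in>S. P t1 (r + \<epsilon>) \<longrightarrow> P t2 (r + \<epsilon>) \<longrightarrow> dist t1 t2 < dist t c" by blast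
    have "P c (r + \<epsilon>)" "P t (r + \<epsilon>)" using c_le that(2) \<epsilon> by auto
    then have "dist t c < dist t c" using imp that(1) cS by blast
    then show False by simp
  qed
  show ?thesis
  proof (intro exI[of _ c] exI[of _ r] conjI ballI allI impI)
    show "c \<in> S" by (rule cS)
    show "r \<le> b" if "t \<in> S" "eventually (\<lambda>n. dist (l n) t \<le> b) sequentially" for t b
      using r_le that unfolding P_def by blast
    show "eventually (\<lambda>n. dist (l n) c \<le> b) sequentially" if "r < b" for b
      using c_le[OF that] unfolding P_def .
    show "t = c" if "t \<in> S" "\<forall>b>r. eventually (\<lambda>n. dist (l n) t \<le> b) sequentially" for t
      using uniq that unfolding P_def by blast
  qed
qed

end

section \<open>Monotone generalized nonexpansive mappings\<close>

locale monotone_nonexpansive_map = uc_hyperbolic H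
  for H :: "'a::{complete_space,order} \<Rightarrow> 'a \<Rightarrow> real \<Rightarrow> 'a" +
  fixes C :: "'a set" and T :: "'a \<Rightarrow> 'a" and \<alpha> :: real
  assumes up_closed: "closed {a::'a..}" and up_convex: "hconvex H {a..}"
    and down_closed: "closed {..a::'a}" and down_convex: "hconvex H {..a}"
    and C_closed: "closed C" and C_convex: "hconvex H C"
    and T_mem: "x \<in> C \<Longrightarrow> T x \<in> C"
    and T_mono: "x \<in> C \<Longrightarrow> y \<in> C \<Longrightarrow> x \<le> y \<Longrightarrow> T x \<le> T y"
    and \<alpha>: "0 \<le> \<alpha>" "\<alpha> < 1"
    and nonexp: "x \<in> C \<Longrightarrow> y \<in> C \<Longrightarrow> x \<le> y \<Longrightarrow> dist x (T x) \<le> 2 * dist x y \<Longrightarrow>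
      dist (T x) (T y) \<le> \<alpha> * dist (T x) y + \<alpha> * dist x (T y) + (1 - 2 * \<alpha>) * dist x y"
begin

abbreviation F :: "'a set" where "F \<equiv> fixed_points C T"

abbreviation D :: "'a \<Rightarrow> real" where "D x \<equiv> dist x (T x)"

lemma complete_space_UNIV: "complete (UNIV :: 'a set)"
  unfolding complete_def using Cauchy_convergent by (auto simp: convergent_def)

lemma F_D: "p \<in> F \<Longrightarrow> p \<in> C" "p \<in> F \<Longrightarrow> T p = p"
  by (auto simp: fixed_points_def)

lemma H_mem: "u \<in> C \<Longrightarrow> v \<in> C \<Longrightarrow> 0 \<le> t \<Longrightarrow> t \<le> 1 \<Longrightarrow> H u v t \<in> C"
  by (rule hconvexD[OF C_convex])

lemma H_ge: "a \<le> u \<Longrightarrow> a \<le> v \<Longrightarrow> 0 \<le> t \<Longrightarrow> t \<le> 1 \<Longrightarrow> a \<le> H u v t"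
  using hconvexD[OF up_convex[of a], of u v t] by auto

lemma H_le: "u \<le> a \<Longrightarrow> v \<le> a \<Longrightarrow> 0 \<le> t \<Longrightarrow> t \<le> 1 \<Longrightarrow> H u v t \<le> a"
  using hconvexD[OF down_convex[of a], of u v t] by auto

lemma H_between:
  assumes "u \<le> v" "0 \<le> t" "t \<le> 1"
  shows "u \<le> H u v t" "H u v t \<le> v"
  by (rule H_ge H_le; use assms in simp)+

lemma limit_ge: "s \<longlonglongrightarrow> q \<Longrightarrow> (\<And>n. a \<le> s n) \<Longrightarrow> a \<le> q" for s :: "nat \<Rightarrow> 'a"
  using closed_sequentially[OF up_closed[of a], of s q] by auto

lemma D_T_le:
  assumes "x \<in> C" "x \<le> T x"
  shows "D (T x) \<le> D x"
proof -
  have "D (T x) \<le> \<alpha> * dist (T x) (T x) + \<alpha> * dist x (T (T x)) + (1 - 2 * \<alpha>) * D x"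
    using assms by (intro nonexp T_mem) auto
  also have "\<alpha> * dist x (T (T x)) \<le> \<alpha> * (D x + D (T x))"
    using \<alpha> by (intro mult_left_mono dist_triangle) auto
  finally have "(1 - \<alpha>) * D (T x) \<le> (1 - \<alpha>) * D x" by (simp add: algebra_simps)
  then show ?thesis using \<alpha> by simp
qed

text \<open>
  The defining inequality can be used only with the smaller point on the left, so for \<^term>\<open>x\<close> below
  a fixed point \<^term>\<open>p\<close> its premise is a condition on the displacement \<^term>\<open>D x\<close>. A point \<^term>\<open>x\<close>
  with \<^prop>\<open>2 * dist x p < D x\<close> is called bad for \<^term>\<open>p\<close>: its image may be farther from \<^term>\<open>p\<close>.
\<close>

lemma quasi_nonexpansive:
  assumes "x \<in> C" "p \<in> F" "x \<le> p" "D x \<le> 2 * dist x p"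
  shows "dist (T x) p \<le> dist x p"
proof -
  have "dist (T x) (T p) \<le> \<alpha> * dist (T x) p + \<alpha> * dist x (T p) + (1 - 2 * \<alpha>) * dist x p"
    using assms F_D by (intro nonexp) auto
  then have "(1 - \<alpha>) * dist (T x) p \<le> (1 - \<alpha>) * dist x p"
    using F_D(2)[OF assms(2)] by (simp add: algebra_simps)
  then show ?thesis using \<alpha> by simp
qed

definition K :: real where "K = 3 / (1 - \<alpha>)"

lemma K_ge: "3 \<le> K" "0 < K"
  using \<alpha> by (auto simp: K_def field_simps)

text \<open>
  An almost fixed point \<^term>\<open>x\<close> controls the mapping above \<^term>\<open>x\<close>. If the pair \<^term>\<open>x\<close>, \<^term>\<open>y\<close> does not
  satisfy the premise of the defining inequality, then \<^term>\<open>T x\<close>, \<^term>\<open>y\<close> does, at the expense of two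
  more displacements; \<^term>\<open>K\<close> is a common bound for both cases.
\<close>

lemma dist_T_le_of_displacement:
  assumes "x \<in> C" "y \<in> C" "x \<le> y" and "D x \<le> 2 * dist x y \<or> (x \<le> T x \<and> T x \<le> y)"
  shows "dist x (T y) \<le> dist x y + K * D x"
proof -
  have basic: "dist u (T v) \<le> dist u v + (1 + \<alpha>) / (1 - \<alpha>) * D u"
    if "u \<in> C" "v \<in> C" "u \<le> v" "D u \<le> 2 * dist u v" for u v
  proof -
    have 1: "dist (T u) (T v) \<le> \<alpha> * dist (T u) v + \<alpha> * dist u (T v) + (1 - 2 * \<alpha>) * dist u v"
      using that by (intro nonexp) auto
    have 2: "dist u (T v) \<le> D u + dist (T u) (T v)" by (rule dist_triangle)
    have "\<alpha> * dist (T u) v \<le> \<alpha> * (D u + dist u v)"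
      using \<alpha> dist_triangle2[of "T u" v u] by (intro mult_left_mono) (auto simp: dist_commute)
    then have "(1 - \<alpha>) * dist u (T v) \<le> (1 - \<alpha>) * dist u v + (1 + \<alpha>) * D u"
      using 1 2 by (simp add: algebra_simps)
    then show ?thesis using \<alpha> by (simp add: field_simps)
  qed
  have "(1 + \<alpha>) / (1 - \<alpha>) + 2 = (3 - \<alpha>) / (1 - \<alpha>)" using \<alpha> by (simp add: field_simps)
  also have "\<dots> \<le> K" unfolding K_def using \<alpha> by (intro divide_right_mono) auto
  finally have c: "(1 + \<alpha>) / (1 - \<alpha>) + 2 \<le> K" .
  have pos: "0 \<le> (1 + \<alpha>) / (1 - \<alpha>)" using \<alpha> by simp
  show ?thesis
  proof (cases "D x \<le> 2 * dist x y")
    case True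
    then have "dist x (T y) \<le> dist x y + (1 + \<alpha>) / (1 - \<alpha>) * D x" using basic assms by blast
    moreover have "(1 + \<alpha>) / (1 - \<alpha>) * D x \<le> K * D x" using c by (intro mult_right_mono) auto
    ultimately show ?thesis by linarith
  next
    case False
    then have x: "x \<le> T x" "T x \<le> y" using assms(4) by auto
    have "D (T x) \<le> D x" using D_T_le assms(1) x by simp
    moreover have "D x \<le> dist x y + dist (T x) y" by (rule dist_triangle2)
    ultimately have "D (T x) \<le> 2 * dist (T x) y" using False by linarith
    then have "dist (T x) (T y) \<le> dist (T x) y + (1 + \<alpha>) / (1 - \<alpha>) * D (T x)"
      using basic assms x T_mem by blast
    also have "(1 + \<alpha>) / (1 - \<alpha>) * D (T x) \<le> (1 + \<alpha>) / (1 - \<alpha>) * D x"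
      using pos \<open>D (T x) \<le> D x\<close> by (rule mult_left_mono[rotated])
    finally have "dist (T x) (T y) \<le> dist (T x) y + (1 + \<alpha>) / (1 - \<alpha>) * D x" by simp
    moreover have "dist x (T y) \<le> D x + dist (T x) (T y)" by (rule dist_triangle)
    moreover have "dist (T x) y \<le> D x + dist x y"
      using dist_triangle[of "T x" y x] by (simp add: dist_commute)
    moreover have "((1 + \<alpha>) / (1 - \<alpha>) + 2) * D x \<le> K * D x" using c by (intro mult_right_mono) auto
    ultimately show ?thesis by (simp add: distrib_right)
  qed
qed

section \<open>Sequences with vanishing displacement\<close>

text \<open>
  Starting at \<^term>\<open>x\<close> with \<^prop>\<open>x \<le> T x\<close>, an increasing sequence of almost fixed points. For
  \<^prop>\<open>0 < \<alpha>\<close> these are the iterates of \<^term>\<open>T\<close>; for \<^prop>\<open>\<alpha> = 0\<close> the iterates may oscillate and the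
  averaged iteration takes their place. In both cases the sequence is asymptotically regular.
\<close>

primrec reg :: "'a \<Rightarrow> nat \<Rightarrow> 'a" where
  "reg x 0 = x"
| "reg x (Suc n) = H (reg x n) (T (reg x n)) (if \<alpha> = 0 then 1/2 else 1)"

lemma reg_below:
  assumes "x \<in> C" "x \<le> T x"
  shows "reg x n \<in> C \<and> reg x n \<le> T (reg x n)"
proof (induction n)
  case 0 then show ?case using assms by simp
next
  case (Suc n)
  let ?t = "if \<alpha> = 0 then 1/2 else 1 :: real"
  have le: "reg x n \<le> reg x (Suc n)" "reg x (Suc n) \<le> T (reg x n)"
    unfolding reg.simps using Suc by (intro H_between; simp)+
  have mem: "reg x (Suc n) \<in> C"
    unfolding reg.simps using Suc T_mem by (intro H_mem) auto
  then show ?case using le T_mono[of "reg x n" "reg x (Suc n)"] Suc by (meson order_trans)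
qed

lemma reg_step:
  assumes "x \<in> C" "x \<le> T x"
  shows "reg x n \<le> reg x (Suc n)" "reg x (Suc n) \<le> T (reg x n)"
  unfolding reg.simps using reg_below[OF assms, of n] by (intro H_between; simp)+

lemma reg_incseq:
  assumes "x \<in> C" "x \<le> T x" "m \<le> n"
  shows "reg x m \<le> reg x n" "T (reg x m) \<le> T (reg x n)"
proof -
  show le: "reg x m \<le> reg x n" by (rule lift_Suc_mono_le[of "reg x", OF reg_step(1)[OF assms(1,2)] assms(3)])
  show "T (reg x m) \<le> T (reg x n)" using reg_below assms le by (intro T_mono) auto
qed

lemma D_reg_Suc_le:
  assumes "x \<in> C" "x \<le> T x"
  shows "D (reg x (Suc n)) \<le> D (reg x n)"
proof -
  define u where "u = reg x n"
  have u: "u \<in> C" "u \<le> T u" using reg_below[OF assms] by (auto simp: u_def)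
  show ?thesis
  proof (cases "\<alpha> = 0")
    case False
    have "reg x (Suc n) = T u" unfolding u_def reg.simps by (simp only: if_not_P[OF False] H_1)
    then show ?thesis using D_T_le[OF u] unfolding u_def by metis
  next
    case True
    define v where "v = H u (T u) (1/2)"
    have eq: "reg x (Suc n) = v" unfolding u_def v_def reg.simps by (simp only: if_P[OF True])
    have v: "v \<in> C" "u \<le> v"
      unfolding v_def using H_mem[OF u(1) T_mem[OF u(1)], of "1/2"] H_between(1)[OF u(2), of "1/2"]
      by simp_all
    have d: "dist u v = D u / 2" "dist (T u) v = D u / 2"
      using dist_H_left(1)[of "1/2" u "T u"] dist_H_left(2)[of "1/2" "T u" u]
      unfolding v_def by (simp_all add: dist_commute)
    have "dist (T u) (T v) \<le> 0 * dist (T u) v + 0 * dist u (T v) + (1 - 2 * 0) * dist u v"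
      using nonexp[OF u(1) v] d(1) unfolding True by linarith
    then have "D v \<le> D u" using dist_triangle[of v "T v" "T u"] d by (simp add: dist_commute)
    then show ?thesis unfolding eq unfolding u_def .
  qed
qed

lemma D_reg_antimono:
  assumes "x \<in> C" "x \<le> T x" "m \<le> n"
  shows "D (reg x n) \<le> D (reg x m)"
  using lift_Suc_antimono_le[of "\<lambda>n. D (reg x n)"] D_reg_Suc_le[OF assms(1,2)] assms(3) by blast

text \<open>
  As long as the points are not bad for \<^term>\<open>p\<close>, their images are no farther from \<^term>\<open>p\<close>. A bad
  point \<^term>\<open>u\<close> is within half of its displacement of \<^term>\<open>p\<close>, hence \<^term>\<open>T u\<close> is within
  \<^term>\<open>3 / 2 * D u\<close>, and displacements do not increase.
\<close>

lemma reg_bounded: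
  assumes "x \<in> C" "x \<le> T x" "p \<in> F" "x \<le> p"
  defines "B \<equiv> max (dist x p) (3 / 2 * D x)"
  shows "reg x n \<le> p" "T (reg x n) \<le> p" "dist (reg x n) p \<le> B" "dist (T (reg x n)) p \<le> B"
proof -
  have T: "T u \<le> p \<and> dist (T u) p \<le> B" if u: "u \<in> C" "u \<le> p" "dist u p \<le> B" "D u \<le> D x" for u
  proof
    show "T u \<le> p" using T_mono[of u p] u F_D[OF assms(3)] by simp
    show "dist (T u) p \<le> B"
    proof (cases "D u \<le> 2 * dist u p")
      case True then show ?thesis using quasi_nonexpansive[of u p] u assms(3) by linarith
    next
      case False
      have "dist (T u) p \<le> D u + dist u p" using dist_triangle[of "T u" p u] by (simp add: dist_commute)
      then show ?thesis using False u(4) by (simp add: B_def)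
    qed
  qed
  have main: "reg x n \<le> p \<and> dist (reg x n) p \<le> B" for n
  proof (induction n)
    case 0 then show ?case using assms by (simp add: B_def)
  next
    case (Suc n)
    have D: "D (reg x n) \<le> D x" using D_reg_antimono[OF assms(1,2), of 0 n] by simp
    have "T (reg x n) \<le> p \<and> dist (T (reg x n)) p \<le> B"
      using T D reg_below[OF assms(1,2)] Suc by blast
    then have "dist p (reg x (Suc n)) \<le> B"
      unfolding reg.simps using Suc by (intro dist_H_ball) (auto simp: dist_commute)
    moreover have "reg x (Suc n) \<le> p" using reg_step[OF assms(1,2), of n] \<open>T _ \<le> p \<and> _\<close> by (meson order_trans)
    ultimately show ?case by (simp add: dist_commute)
  qed
  show "reg x n \<le> p" "dist (reg x n) p \<le> B" using main by auto
  have "D (reg x n) \<le> D x" using D_reg_antimono[OF assms(1,2), of 0 n] by simp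
  then show "T (reg x n) \<le> p" "dist (T (reg x n)) p \<le> B"
    using T main reg_below[OF assms(1,2)] by blast+
qed

text \<open>
  The displacements decrease to some \<^term>\<open>d\<close>. If \<^term>\<open>d\<close> were positive, the sequence would in the limit
  move along a straight line with steps of constant length, and so could not be bounded.
\<close>

lemma D_reg_tendsto_0:
  assumes x: "x \<in> C" "x \<le> T x" and bd: "\<And>n. dist (reg x n) p \<le> B" "\<And>n. dist (T (reg x n)) p \<le> B"
  shows "(\<lambda>n. D (reg x n)) \<longlonglongrightarrow> 0"
proof -
  define L where "L = reg x"
  have LC: "L n \<in> C" and LT: "L n \<le> T (L n)" for n using reg_below[OF x] by (auto simp: L_def)
  have Lmono: "L m \<le> L n" if "m \<le> n" for m n using reg_incseq[OF x that] by (simp add: L_def)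
  have Ddec: "D (L n) \<le> D (L m)" if "m \<le> n" for m n using D_reg_antimono[OF x that] by (simp add: L_def)
  have "decseq (\<lambda>n. D (L n))" using Ddec by (simp add: decseq_def)
  then obtain d where d: "(\<lambda>n. D (L n)) \<longlonglongrightarrow> d" "\<And>n. d \<le> D (L n)"
    using decseq_convergent[of "\<lambda>n. D (L n)" 0] by auto
  have d0: "0 \<le> d" using LIMSEQ_le_const[OF d(1), of 0] by auto
  have "d = 0"
  proof (rule ccontr)
    assume "d \<noteq> 0"
    then have dpos: "0 < d" using d0 by simp
    show False
    proof (cases "\<alpha> = 0")
      case False
      then have \<alpha>pos: "0 < \<alpha>" using \<alpha> by simp
      have Suc_eq: "L (Suc n) = T (L n)" for n
        unfolding L_def reg.simps by (simp only: if_not_P[OF False] H_1)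
      have lim: "(\<lambda>i. dist (L i) (L (i + k))) \<longlonglongrightarrow> real k * d" for k
      proof (induction k rule: less_induct)
        case (less k)
        consider "k = 0" | "k = 1" | j where "k = Suc (Suc j)" by (metis One_nat_def not0_implies_Suc)
        then show ?case
        proof cases
          case 1 then show ?thesis by simp
        next
          case 2 then show ?thesis using d(1) by (simp add: Suc_eq)
        next
          case (3 j)
          have IH1: "(\<lambda>i. dist (L i) (L (i + Suc j))) \<longlonglongrightarrow> real (Suc j) * d"
            by (rule less.IH) (use 3 in simp)
          have IH0: "(\<lambda>i. dist (L i) (L (i + j))) \<longlonglongrightarrow> real j * d"
            by (rule less.IH) (use 3 in simp)
          have IH1': "(\<lambda>i. dist (L (Suc i)) (L (Suc i + Suc j))) \<longlonglongrightarrow> real (Suc j) * d"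
            using LIMSEQ_Suc[OF IH1] .
          have IH0': "(\<lambda>i. dist (L (Suc i)) (L (Suc i + j))) \<longlonglongrightarrow> real j * d"
            using LIMSEQ_Suc[OF IH0] .
          (* lo is what the defining inequality for L i and L (i + Suc j) says about dist (L i) (L (i + k)),
             hi comes from the triangle inequality; both tend to the same limit. *)
          define lo where "lo i = (dist (L (Suc i)) (L (Suc i + Suc j)) - \<alpha> * dist (L (Suc i)) (L (Suc i + j))
              - (1 - 2 * \<alpha>) * dist (L i) (L (i + Suc j))) / \<alpha>" for i
          have "lo \<longlonglongrightarrow> (real (Suc j) * d - \<alpha> * (real j * d) - (1 - 2 * \<alpha>) * (real (Suc j) * d)) / \<alpha>"
            unfolding lo_def using \<alpha>pos by (intro tendsto_intros IH1 IH0' IH1') auto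
          also have "(real (Suc j) * d - \<alpha> * (real j * d) - (1 - 2 * \<alpha>) * (real (Suc j) * d)) / \<alpha> = real k * d"
            using \<alpha>pos 3 by (simp add: field_simps)
          finally have lo: "lo \<longlonglongrightarrow> real k * d" .
          define hi where "hi i = dist (L i) (L (i + Suc j)) + D (L (i + Suc j))" for i
          have "hi \<longlonglongrightarrow> real (Suc j) * d + d"
            unfolding hi_def by (intro tendsto_intros IH1 LIMSEQ_ignore_initial_segment d(1))
          then have hi: "hi \<longlonglongrightarrow> real k * d" using 3 by (simp add: algebra_simps)
          have ev: "eventually (\<lambda>i. D (L i) < 2 * dist (L i) (L (i + Suc j))) sequentially"
          proof -
            have "(\<lambda>i. 2 * dist (L i) (L (i + Suc j)) - D (L i)) \<longlonglongrightarrow> 2 * (real (Suc j) * d) - d"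
              by (intro tendsto_intros IH1 d(1))
            moreover have "0 < 2 * (real (Suc j) * d) - d"
              using dpos by (simp add: algebra_simps add_pos_nonneg)
            ultimately have "eventually (\<lambda>i. 0 < 2 * dist (L i) (L (i + Suc j)) - D (L i)) sequentially"
              by (rule order_tendstoD(1))
            then show ?thesis by (rule eventually_mono) linarith
          qed
          have "eventually (\<lambda>i. lo i \<le> dist (L i) (L (i + k))) sequentially"
          proof (rule eventually_mono[OF ev])
            fix i assume act: "D (L i) < 2 * dist (L i) (L (i + Suc j))"
            have "dist (T (L i)) (T (L (i + Suc j))) \<le> \<alpha> * dist (T (L i)) (L (i + Suc j))
                + \<alpha> * dist (L i) (T (L (i + Suc j))) + (1 - 2 * \<alpha>) * dist (L i) (L (i + Suc j))"
              using act by (intro nonexp LC Lmono) auto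
            then show "lo i \<le> dist (L i) (L (i + k))"
              unfolding lo_def using \<alpha>pos 3 by (simp add: Suc_eq[symmetric] field_simps)
          qed
          moreover have "eventually (\<lambda>i. dist (L i) (L (i + k)) \<le> hi i) sequentially"
            unfolding hi_def using 3
            by (intro always_eventually allI) (simp add: Suc_eq dist_triangle)
          ultimately show ?thesis by (rule tendsto_sandwich[OF _ _ lo hi])
        qed
      qed
      obtain k :: nat where k: "2 * B < real k * d" using reals_Archimedean3[OF dpos] by blast
      have "real k * d \<le> 2 * B"
      proof (rule LIMSEQ_le_const2[OF lim])
        have "dist (L i) (L (i + k)) \<le> 2 * B" for i
          using dist_triangle2[of "L i" "L (i + k)" p] bd(1)[of i] bd(1)[of "i + k"] unfolding L_def by linarith
        then show "\<exists>N. \<forall>i\<ge>N. dist (L i) (L (i + k)) \<le> 2 * B" by blast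
      qed
      then show False using k by simp
    next
      case True
      have Suc_eq: "L (Suc n) = H (L n) (T (L n)) (1/2)" for n
        unfolding L_def reg.simps by (simp only: if_P[OF True])
      have step: "dist (L n) (L (Suc n)) = D (L n) / 2" for n by (simp add: Suc_eq dist_H_left)
      have Tstep: "dist (T (L n)) (T (L (Suc n))) \<le> D (L n) / 2" for n
        using nonexp[OF LC LC Lmono, of n "Suc n"] step[of n] True by simp
      have Tk: "dist (T (L i)) (T (L (i + k))) \<le> real k / 2 * D (L i)" for i k
      proof (induction k)
        case (Suc k)
        have "dist (T (L i)) (T (L (i + Suc k))) \<le> dist (T (L i)) (T (L (i + k))) + dist (T (L (i + k))) (T (L (Suc (i + k))))"
          by (simp add: dist_triangle)
        also have "\<dots> \<le> real k / 2 * D (L i) + D (L i) / 2"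
          using Suc Tstep[of "i + k"] Ddec[of i "i + k"] by simp
        finally show ?case by (simp add: field_simps)
      qed simp
      (* The distance of T (L (i + k)) from the midpoint L (Suc i) of L i and T (L i) is known in the
         limit, and its distance from T (L i) is at most k half steps. So it is far from L i. *)
      have lim: "(\<lambda>i. dist (L i) (T (L (i + k)))) \<longlonglongrightarrow> (1 + real k / 2) * d" for k
      proof (induction k)
        case 0 then show ?case using d(1) by simp
      next
        case (Suc k)
        define lo where "lo i = 2 * dist (L (Suc i)) (T (L (Suc i + k))) - real (Suc k) / 2 * D (L i)" for i
        define hi where "hi i = D (L i) + real (Suc k) / 2 * D (L i)" for i
        have "lo \<longlonglongrightarrow> 2 * ((1 + real k / 2) * d) - real (Suc k) / 2 * d"
          unfolding lo_def using LIMSEQ_Suc[OF Suc] by (intro tendsto_intros d(1)) auto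
        moreover have "2 * ((1 + real k / 2) * d) - real (Suc k) / 2 * d = (1 + real (Suc k) / 2) * d"
          by (simp add: field_simps)
        ultimately have lo: "lo \<longlonglongrightarrow> (1 + real (Suc k) / 2) * d" by simp
        have "hi \<longlonglongrightarrow> d + real (Suc k) / 2 * d"
          unfolding hi_def by (intro tendsto_intros d(1))
        moreover have "d + real (Suc k) / 2 * d = (1 + real (Suc k) / 2) * d" by (simp add: field_simps)
        ultimately have hi: "hi \<longlonglongrightarrow> (1 + real (Suc k) / 2) * d" by simp
        have "lo i \<le> dist (L i) (T (L (i + Suc k)))" for i
        proof -
          have "dist (T (L (i + Suc k))) (L (Suc i)) \<le> (1 - 1/2) * dist (T (L (i + Suc k))) (L i)
              + 1/2 * dist (T (L (i + Suc k))) (T (L i))"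
            unfolding Suc_eq by (rule dist_H_le) auto
          then show ?thesis using Tk[of i "Suc k"] unfolding lo_def by (simp add: dist_commute)
        qed
        moreover have "dist (L i) (T (L (i + Suc k))) \<le> hi i" for i
          using dist_triangle[of "L i" "T (L (i + Suc k))" "T (L i)"] Tk[of i "Suc k"] unfolding hi_def by linarith
        ultimately show ?case
          by (intro tendsto_sandwich[OF _ _ lo hi] always_eventually allI)
      qed
      obtain k :: nat where k: "4 * B < real k * d" using reals_Archimedean3[OF dpos] by blast
      have "(1 + real k / 2) * d \<le> 2 * B"
      proof (rule LIMSEQ_le_const2[OF lim])
        have "dist (L i) (T (L (i + k))) \<le> 2 * B" for i
          using dist_triangle2[of "L i" "T (L (i + k))" p] bd(1)[of i] bd(2)[of "i + k"] unfolding L_def by linarith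
        then show "\<exists>N. \<forall>i\<ge>N. dist (L i) (T (L (i + k))) \<le> 2 * B" by blast
      qed
      then show False using k dpos by (simp add: algebra_simps)
    qed
  qed
  then show ?thesis using d(1) by (simp add: L_def)
qed

text \<open>
  The point takes the place of a weak limit of the sequence. It is a common point of the
  decreasing sets of points of \<^term>\<open>C\<close> between \<^term>\<open>T (reg x n)\<close> and all fixed points.
\<close>

lemma upper_bound_below_fixed_points:
  assumes x: "x \<in> C" "x \<le> T x" and F: "\<And>p. p \<in> F \<Longrightarrow> x \<le> p" and p0: "p0 \<in> F"
  shows "\<exists>t\<in>C. (\<forall>i. T (reg x i) \<le> t) \<and> (\<forall>p\<in>F. t \<le> p) \<and> dist p0 t \<le> max (dist x p0) (3 / 2 * D x)"
proof -
  define L where "L = reg x"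
  define B where "B = max (dist x p0) (3 / 2 * D x)"
  note bd = reg_bounded[OF x p0 F[OF p0], folded B_def L_def]
  have LC: "L n \<in> C" for n using reg_below[OF x] by (auto simp: L_def)
  have TLmono: "T (L m) \<le> T (L n)" if "m \<le> n" for m n using reg_incseq[OF x that] by (simp add: L_def)
  have TLF: "T (L n) \<le> p" if "p \<in> F" for n p
    using reg_bounded(2)[OF x that F[OF that]] by (simp add: L_def)
  define A where "A n = C \<inter> {T (L n)..} \<inter> (\<Inter>p\<in>F. {..p})" for n
  have A_closed: "closed (A n)" for n
    unfolding A_def using C_closed up_closed down_closed by (intro closed_Int closed_INT) auto
  have A_convex: "hconvex H (A n)" for n
    unfolding A_def hconvex_def by (auto intro!: H_mem H_ge H_le)
  have A_dec: "A (Suc n) \<subseteq> A n" for n unfolding A_def using TLmono[of n "Suc n"] by fastforce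
  have A_meets: "\<exists>a\<in>A n. dist p0 a \<le> B" for n
    using LC T_mem TLF bd(4) by (intro bexI[of _ "T (L n)"]) (auto simp: A_def dist_commute)
  obtain t0 where t0: "\<And>n. t0 \<in> A n" "dist p0 t0 \<le> B"
    by (rule nested_convex_Int_nonempty[of A, OF complete_space_UNIV A_closed A_convex A_dec A_meets]) (rule that)
  then show ?thesis unfolding A_def L_def B_def by (intro bexI[of _ t0]) auto
qed

text \<open>
  Among the common upper bounds of the sequence that lie below all fixed points, the asymptotic
  centre is mapped to a point with no larger asymptotic radius, hence fixed. So there is a least fixed
  point, and no point of that set has a smaller asymptotic radius.
\<close>

lemma least_fixed_point_is_center:
  assumes x: "x \<in> C" "x \<le> T x" and F: "F \<noteq> {}" "\<And>p. p \<in> F \<Longrightarrow> x \<le> p"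
  shows "\<exists>e\<in>F. (\<forall>p\<in>F. e \<le> p) \<and>
    (\<forall>t\<in>C. \<forall>b b'. (\<forall>i. T (reg x i) \<le> t) \<longrightarrow> (\<forall>p\<in>F. t \<le> p) \<longrightarrow>
       eventually (\<lambda>i. dist (reg x i) t \<le> b) sequentially \<longrightarrow> b < b' \<longrightarrow>
       eventually (\<lambda>i. dist (reg x i) e \<le> b') sequentially)"
proof -
  define L where "L = reg x"
  obtain p0 where p0: "p0 \<in> F" using F by blast
  define B where "B = max (dist x p0) (3 / 2 * D x)"
  note bd = reg_bounded[OF x p0 F(2)[OF p0], folded B_def L_def]
  have D0: "(\<lambda>n. D (L n)) \<longlonglongrightarrow> 0"
    unfolding L_def by (rule D_reg_tendsto_0[OF x, of p0 B]) (use bd in \<open>auto simp: L_def\<close>)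
  have LC: "L n \<in> C" and LT: "L n \<le> T (L n)" for n using reg_below[OF x] by (auto simp: L_def)
  define S where "S = C \<inter> (\<Inter>n. {T (L n)..}) \<inter> (\<Inter>p\<in>F. {..p})"
  have "closed S"
    unfolding S_def using C_closed up_closed down_closed by (intro closed_Int closed_INT) auto
  moreover have "hconvex H S"
    unfolding S_def hconvex_def by (auto intro!: H_mem H_ge H_le)
  moreover obtain t0 where t0: "t0 \<in> S" "dist p0 t0 \<le> B"
    using upper_bound_below_fixed_points[OF x F(2) p0] unfolding S_def L_def B_def by auto
  ultimately have S: "closed S" "hconvex H S" "t0 \<in> S" by auto
  have "dist (L n) t0 \<le> 2 * B" for n
    using dist_triangle2[of "L n" t0 p0] bd(3)[of n] t0(2) by (simp add: dist_commute)
  from asymptotic_center[where l = L, OF complete_space_UNIV S this]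
  obtain c r where c: "c \<in> S"
    and r_le: "\<forall>t\<in>S. \<forall>b. eventually (\<lambda>n. dist (L n) t \<le> b) sequentially \<longrightarrow> r \<le> b"
    and c_le: "\<forall>b>r. eventually (\<lambda>n. dist (L n) c \<le> b) sequentially"
    and uniq: "\<forall>t\<in>S. (\<forall>b>r. eventually (\<lambda>n. dist (L n) t \<le> b) sequentially) \<longrightarrow> t = c"
    by (elim exE conjE)
  have S_iff: "t \<in> S \<longleftrightarrow> t \<in> C \<and> (\<forall>n. T (L n) \<le> t) \<and> (\<forall>p\<in>F. t \<le> p)" for t
    unfolding S_def by auto
  have cC: "c \<in> C" and cL: "T (L n) \<le> c" and cF: "p \<in> F \<Longrightarrow> c \<le> p" for n p using c S_iff by auto
  have Lc: "L n \<le> c" for n using LT cL by (meson order_trans)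
  have "T c \<in> S"
    unfolding S_iff
  proof (intro conjI allI ballI)
    show "T c \<in> C" using cC T_mem by simp
    show "T (L n) \<le> T c" for n using Lc LC cC by (intro T_mono) auto
    show "T c \<le> p" if "p \<in> F" for p using T_mono[of c p] cC cF that F_D by auto
  qed
  moreover have "eventually (\<lambda>n. dist (L n) (T c) \<le> b) sequentially" if "r < b" for b
  proof -
    define \<epsilon> where "\<epsilon> = (b - r) / 2"
    have \<epsilon>: "0 < \<epsilon>" "r < b - \<epsilon>" unfolding \<epsilon>_def using that by (simp_all add: field_simps)
    have "(\<lambda>n. K * D (L n)) \<longlonglongrightarrow> K * 0" by (intro tendsto_intros D0)
    then have "eventually (\<lambda>n. K * D (L n) < \<epsilon>) sequentially"
      using \<epsilon> by (intro order_tendstoD) auto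
    then show ?thesis using c_le[rule_format, OF \<epsilon>(2)]
    proof eventually_elim
      case (elim n)
      have "dist (L n) (T c) \<le> dist (L n) c + K * D (L n)"
        using LC cC Lc LT cL by (intro dist_T_le_of_displacement) auto
      then show ?case using elim by linarith
    qed
  qed
  ultimately have "T c = c" using uniq by blast
  then have cfix: "c \<in> F" using cC by (simp add: fixed_points_def)
  show ?thesis
  proof (intro bexI[OF _ cfix] conjI ballI allI impI)
    show "c \<le> p" if "p \<in> F" for p using cF that .
    fix t b b' assume t: "t \<in> C" "\<forall>i. T (reg x i) \<le> t" "\<forall>p\<in>F. t \<le> p"
      "eventually (\<lambda>i. dist (reg x i) t \<le> b) sequentially" "b < b'"
    then have "t \<in> S" unfolding S_iff L_def by blast
    then have "r \<le> b" using r_le t(4) unfolding L_def by blast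
    then have "r < b'" using t(5) by simp
    then show "eventually (\<lambda>i. dist (reg x i) c \<le> b') sequentially"
      using c_le unfolding L_def by blast
  qed
qed

section \<open>Almost fixed points below a fixed point\<close>

text \<open>
  The image of a point \<^term>\<open>V\<close> of the segment is not farther from \<^term>\<open>l\<close> and from \<^term>\<open>p\<close> than
  \<^term>\<open>V\<close> is, up to small errors, and positions on a geodesic are nearly unique. The estimate
  towards \<^term>\<open>p\<close> needs a bound on \<^term>\<open>D V\<close>. It is provided by the point of the segment a
  little below \<^term>\<open>V\<close>, so the proof advances along the segment in steps of fixed length; the
  errors do not accumulate, since the distance estimates always refer to \<^term>\<open>l\<close> and \<^term>\<open>p\<close>.
\<close>

lemma almost_fixed_on_segment:
  assumes \<sigma>: "0 < \<sigma>" and \<eta>: "0 < \<eta>"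
  shows "\<exists>\<zeta>>0. \<forall>l u p t. l \<in> C \<longrightarrow> u \<in> C \<longrightarrow> p \<in> F \<longrightarrow> l \<le> u \<longrightarrow> u \<le> p \<longrightarrow> D l \<le> \<zeta> \<longrightarrow> dist u p \<le> \<zeta> \<longrightarrow>
    0 \<le> t \<longrightarrow> t \<le> 1 \<longrightarrow> \<sigma> \<le> dist l (H l u t) \<longrightarrow> dist l (H l u t) \<le> R \<longrightarrow> \<sigma> \<le> dist (H l u t) u \<longrightarrow>
    D (H l u t) < \<eta>"
proof -
  define \<eta>' where "\<eta>' = min \<eta> (\<sigma> / (2 * K))"
  have \<eta>': "0 < \<eta>'" "\<eta>' \<le> \<eta>" "K * \<eta>' \<le> \<sigma> / 2"
  proof -
    show "0 < \<eta>'" "\<eta>' \<le> \<eta>" using \<sigma> \<eta> K_ge by (auto simp: \<eta>'_def)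
    have "K * \<eta>' \<le> K * (\<sigma> / (2 * K))" using K_ge by (intro mult_left_mono) (auto simp: \<eta>'_def)
    then show "K * \<eta>' \<le> \<sigma> / 2" using K_ge by simp
  qed
  have "3 * \<eta>' \<le> K * \<eta>'" using K_ge \<eta>' by (intro mult_right_mono) auto
  then have \<eta>'6: "\<eta>' \<le> \<sigma> / 6" using \<eta>' by linarith
  from geodesic_nearly_unique[OF \<eta>'(1), of "R + 1"] obtain \<delta> where \<delta>: "0 < \<delta>"
    and near: "\<And>(u::'a) v p q s t. s \<le> R + 1 \<Longrightarrow> dist u p \<le> s \<Longrightarrow> dist u q \<le> s \<Longrightarrow> dist v p \<le> t \<Longrightarrow>
      dist v q \<le> t \<Longrightarrow> s + t \<le> dist u v + \<delta> \<Longrightarrow> dist p q < \<eta>'"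
    by blast
  define \<zeta> where "\<zeta> = min (min (\<sigma> / 4) \<delta>) 1 / (K + 2)"
  have Kp: "0 < K + 2" using K_ge by simp
  have \<zeta>: "0 < \<zeta>" using \<sigma> \<delta> Kp by (simp add: \<zeta>_def)
  have K2\<zeta>: "(K + 2) * \<zeta> = min (min (\<sigma> / 4) \<delta>) 1" using Kp by (simp add: \<zeta>_def)
  have "K * \<zeta> + 2 * \<zeta> \<le> \<sigma> / 4" "K * \<zeta> + 2 * \<zeta> \<le> \<delta>" "K * \<zeta> + 2 * \<zeta> \<le> 1"
    using K2\<zeta> by (simp_all add: distrib_right)
  then have K\<zeta>: "K * \<zeta> \<le> \<sigma> / 4" "K * \<zeta> + 2 * \<zeta> \<le> \<delta>" "K * \<zeta> \<le> 1" using \<zeta> by linarith+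
  have "3 * \<zeta> \<le> K * \<zeta>" using K_ge \<zeta> by (intro mult_right_mono) auto
  then have \<zeta>4: "\<zeta> \<le> \<sigma> / 12" using K\<zeta> by linarith
  have step: "D V < \<eta>'"
    if h: "l \<in> C" "u \<in> C" "p \<in> F" "l \<le> u" "u \<le> p" "D l \<le> \<zeta>" "dist u p \<le> \<zeta>"
      and V: "D V \<le> 3 / 2 * \<sigma>" "V = H l u t" "0 \<le> t" "t \<le> 1" "\<sigma> / 4 \<le> dist l V" "dist l V \<le> R"
        "\<sigma> \<le> dist V u" for l u p t V
  proof -
    have VC: "V \<in> C" "l \<le> V" "V \<le> u"
      unfolding V(2) using H_mem[OF h(1,2) V(3,4)] H_between[OF h(4) V(3,4)] by auto
    have sum: "dist l V + dist V u = dist l u"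
      using dist_H_left(1)[OF V(3,4), of l u] dist_H_left(2)[OF V(3,4), of u l] V(2)
      by (simp add: dist_commute algebra_simps)
    have Vp: "dist V p \<le> dist V u + \<zeta>" "dist V u - \<zeta> \<le> dist V p"
      using dist_triangle[of V p u] dist_triangle[of V u p] h(7) by (auto simp: dist_commute)
    have Vle: "V \<le> p" using VC(3) h(5) by (rule order_trans)
    have "D V \<le> 2 * dist V p" using V(1,7) Vp \<zeta>4 by linarith
    then have TVp: "dist (T V) p \<le> dist V p"
      using quasi_nonexpansive[OF VC(1) h(3) Vle] by simp
    have "D l \<le> 2 * dist l V" using h(6) V(5) \<zeta>4 \<sigma> by linarith
    then have "dist l (T V) \<le> dist l V + K * D l"
      using dist_T_le_of_displacement[OF h(1) VC(1,2)] by simp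
    moreover have "K * D l \<le> K * \<zeta>" using h(6) K_ge by (intro mult_left_mono) auto
    ultimately have 1: "dist l (T V) \<le> dist l V + K * \<zeta>" by linarith
    have 2: "dist u (T V) \<le> dist V u + 2 * \<zeta>"
      using dist_triangle[of u "T V" p] TVp Vp h(7) by (simp add: dist_commute)
    have "0 \<le> K * \<zeta>" using K_ge \<zeta> by simp
    with 1 2 show ?thesis
      using sum K\<zeta> V(6) \<zeta>
      by (intro near[of "dist l V + K * \<zeta>" l V "T V" u "dist V u + 2 * \<zeta>"]) (simp_all add: dist_commute)
  qed
  have main: "D (H l u t) < \<eta>'"
    if h: "l \<in> C" "u \<in> C" "p \<in> F" "l \<le> u" "u \<le> p" "D l \<le> \<zeta>" "dist u p \<le> \<zeta>"
      and V: "0 \<le> t" "t \<le> 1" "\<sigma> / 4 \<le> dist l (H l u t)" "dist l (H l u t) \<le> R" "\<sigma> \<le> dist (H l u t) u"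
        "dist l (H l u t) \<le> real (j + 2) * (\<sigma> / 4)" for l u p t j
    using V
  proof (induction j arbitrary: t)
    case (0 t)
    define V where "V = H l u t"
    have VC: "V \<in> C" "l \<le> V"
      unfolding V_def using H_mem[OF h(1,2) 0(1,2)] H_between[OF h(4) 0(1,2)] by auto
    have "D l \<le> 2 * dist l V" using h(6) 0(3) \<zeta>4 \<sigma> unfolding V_def by linarith
    then have "dist l (T V) \<le> dist l V + K * D l"
      using dist_T_le_of_displacement[OF h(1) VC] by simp
    moreover have "K * D l \<le> K * \<zeta>" using h(6) K_ge by (intro mult_left_mono) auto
    moreover have "D V \<le> dist l V + dist l (T V)" by (rule dist_triangle3)
    moreover have "dist l V \<le> \<sigma> / 2" using 0(6) by (simp add: V_def)
    ultimately have "D V \<le> 3 / 2 * \<sigma>" using K\<zeta> \<sigma> by linarith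
    then show ?case using step[OF h, of V t] 0 by (simp add: V_def)
  next
    case (Suc j t)
    define V where "V = H l u t"
    define r where "r = dist l u"
    have Vr: "dist l V = t * r" unfolding V_def r_def using Suc.prems(1,2) by (rule dist_H_left)
    show ?case
    proof (cases "dist l V \<le> real (j + 2) * (\<sigma> / 4)")
      case True
      then show ?thesis using Suc unfolding V_def by blast
    next
      case False
      have "2 * (\<sigma> / 4) \<le> real (j + 2) * (\<sigma> / 4)" using \<sigma> by (intro mult_right_mono) auto
      then have a: "\<sigma> / 2 < dist l V" using False by linarith
      have "t * r \<le> 1 * r" using Suc.prems(2) by (intro mult_right_mono) (auto simp: r_def)
      then have rpos: "0 < r" using a Vr \<sigma> by linarith
      define s where "s = t - \<sigma> / 4 / r"
      have sr: "s * r = t * r - \<sigma> / 4" using rpos by (simp add: s_def field_simps)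
      have "\<sigma> / 4 < s * r" using a Vr sr by linarith
      then have s0: "0 \<le> s" using rpos \<sigma> mult_neg_pos[of s r] by linarith
      have st: "s \<le> t" using rpos \<sigma> by (simp add: s_def)
      have s1: "s \<le> 1" using st Suc.prems(2) by linarith
      define W where "W = H l u s"
      have Wr: "dist l W = s * r" unfolding W_def r_def using s0 s1 by (rule dist_H_left)
      have "dist W V = \<bar>s - t\<bar> * r"
        unfolding W_def V_def r_def using s0 s1 Suc.prems(1,2) by (intro dist_H_H) auto
      also have "\<dots> = t * r - s * r" using st by (simp add: algebra_simps)
      finally have WV: "dist W V = \<sigma> / 4" using sr by simp
      have Wu: "dist W u = r - s * r" "dist V u = r - t * r"
        using dist_H_left(2)[OF s0 s1, of u l] dist_H_left(2)[OF Suc.prems(1,2), of u l]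
        by (simp_all add: W_def V_def r_def dist_commute algebra_simps)
      have "D W < \<eta>'"
        unfolding W_def
      proof (rule Suc.IH[OF s0 s1])
        show "\<sigma> / 4 \<le> dist l (H l u s)" using Wr \<open>\<sigma> / 4 < s * r\<close> by (simp add: W_def)
        show "dist l (H l u s) \<le> R" using Wr sr Vr Suc.prems(4) \<sigma> by (simp add: W_def V_def)
        show "\<sigma> \<le> dist (H l u s) u" using Wu sr Suc.prems(5) \<sigma> by (simp add: W_def V_def)
        show "dist l (H l u s) \<le> real (j + 2) * (\<sigma> / 4)"
          using Wr sr Vr Suc.prems(6) by (simp add: W_def V_def algebra_simps)
      qed
      obtain q where q: "0 \<le> q" "q \<le> 1" "V = H W u q"
        using H_final_segment[OF s0 st Suc.prems(2)] unfolding V_def W_def by metis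
      have WC: "W \<in> C" "W \<le> u"
        unfolding W_def using H_mem[OF h(1,2) s0 s1] H_between[OF h(4) s0 s1] by auto
      have WleV: "W \<le> V" unfolding q(3) using H_between(1)[OF WC(2) q(1,2)] .
      have VC: "V \<in> C" unfolding V_def using H_mem[OF h(1,2) Suc.prems(1,2)] .
      have "D W \<le> 2 * dist W V" using \<open>D W < \<eta>'\<close> WV \<eta>'6 \<sigma> by linarith
      then have "dist W (T V) \<le> dist W V + K * D W"
        using dist_T_le_of_displacement[OF WC(1) VC WleV] by simp
      moreover have "K * D W \<le> K * \<eta>'" using \<open>D W < \<eta>'\<close> K_ge by (intro mult_left_mono) auto
      moreover have "D V \<le> dist W V + dist W (T V)" by (rule dist_triangle3)
      ultimately have "D V \<le> 3 / 2 * \<sigma>" using WV \<eta>' \<sigma> by linarith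
      then show ?thesis using step[OF h, of V t] Suc.prems by (simp add: V_def)
    qed
  qed
  show ?thesis
  proof (intro exI[of _ \<zeta>] conjI allI impI \<zeta>)
    fix l u p t
    assume h: "l \<in> C" "u \<in> C" "p \<in> F" "l \<le> u" "u \<le> p" "D l \<le> \<zeta>" "dist u p \<le> \<zeta>"
      and V: "0 \<le> t" "t \<le> 1" "\<sigma> \<le> dist l (H l u t)" "dist l (H l u t) \<le> R" "\<sigma> \<le> dist (H l u t) u"
    obtain j :: nat where j: "R < real j * (\<sigma> / 4)" using reals_Archimedean3[of "\<sigma> / 4"] \<sigma> by auto
    have "real j * (\<sigma> / 4) \<le> real (j + 2) * (\<sigma> / 4)" using \<sigma> by (intro mult_right_mono) auto
    then have "dist l (H l u t) \<le> real (j + 2) * (\<sigma> / 4)" using V(4) j by linarith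
    then show "D (H l u t) < \<eta>" using main[OF h V(1,2) _ V(4,5)] V(3) \<sigma> \<eta>'(2) by fastforce
  qed
qed

text \<open>
  If the segment from an almost fixed point \<open>y\<close> to \<^term>\<open>p\<close> met the sphere of radius \<^term>\<open>D v / 2\<close>
  around \<^term>\<open>v\<close>, there would be an almost fixed point on the sphere. By the defining inequality it would be no
  farther from \<^term>\<open>T v\<close> than from \<^term>\<open>v\<close>, up to a small error, so it would be close to the midpoint of
  \<^term>\<open>v\<close> and \<^term>\<open>T v\<close>. But it is above \<^term>\<open>T v\<close>, and the midpoint, which is below
  \<^term>\<open>T v\<close> and different from it, has a neighbourhood without such points.
\<close>

lemma almost_fixed_in_ball:
  assumes v: "v \<in> C" "v \<le> T v" and p: "p \<in> F" "v \<le> p" and bad: "2 * dist v p < D v"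
  shows "\<exists>\<zeta>>0. \<forall>y\<in>C. T v \<le> y \<longrightarrow> y \<le> p \<longrightarrow> D y \<le> \<zeta> \<longrightarrow> dist y p \<le> R \<longrightarrow> 2 * dist v y < D v"
proof -
  define \<rho> where "\<rho> = D v / 2"
  have \<rho>: "dist v p < \<rho>" "0 < \<rho>" using bad zero_le_dist[of v p] unfolding \<rho>_def by linarith+
  define m where "m = H v (T v) (1/2)"
  have m: "dist v m = \<rho>" "dist (T v) m = \<rho>"
    using dist_H_left(1)[of "1/2" v "T v"] dist_H_left(2)[of "1/2" "T v" v]
    unfolding m_def \<rho>_def by (simp_all add: dist_commute)
  have "m \<noteq> T v" using m(2) \<rho> by auto
  moreover have "m \<le> T v" unfolding m_def using H_between(2)[OF v(2)] by simp
  ultimately have "m \<in> - {T v..}" by auto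
  moreover have "open (- {T v..})" using up_closed by auto
  ultimately obtain d where d: "0 < d" "ball m d \<subseteq> - {T v..}" by (meson open_contains_ball)
  have off_m: "d \<le> dist m y" if "T v \<le> y" for y
    using d(2) that by (force simp: subset_iff not_less)
  from geodesic_nearly_unique[OF d(1), of "\<rho> + 1"] obtain \<delta> where \<delta>: "0 < \<delta>"
    and near: "\<And>(u::'a) v p q s t. s \<le> \<rho> + 1 \<Longrightarrow> dist u p \<le> s \<Longrightarrow> dist u q \<le> s \<Longrightarrow> dist v p \<le> t \<Longrightarrow>
      dist v q \<le> t \<Longrightarrow> s + t \<le> dist u v + \<delta> \<Longrightarrow> dist p q < d"
    by blast
  define \<epsilon> where "\<epsilon> = min 1 (\<delta> / 2) / 2"
  have \<epsilon>: "0 < \<epsilon>" "2 * \<epsilon> \<le> 1" "4 * \<epsilon> \<le> \<delta>" using \<delta> by (auto simp: \<epsilon>_def)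
  define \<zeta>1 where "\<zeta>1 = \<epsilon> / K"
  have \<zeta>1: "0 < \<zeta>1" "K * \<zeta>1 = \<epsilon>" using \<epsilon> K_ge by (auto simp: \<zeta>1_def)
  have no_shell: False
    if y: "y \<in> C" "T v \<le> y" "D y \<le> \<zeta>1" "\<rho> \<le> dist v y" "dist v y \<le> \<rho> + \<epsilon>" for y
  proof -
    have "v \<le> y" using v(2) y(2) by (rule order_trans)
    then have "dist (T v) (T y) \<le> \<alpha> * dist (T v) y + \<alpha> * dist v (T y) + (1 - 2 * \<alpha>) * dist v y"
      using y(4) by (intro nonexp v y) (auto simp: \<rho>_def)
    moreover have "dist (T v) y \<le> dist (T v) (T y) + D y"
      by (rule dist_triangle2)
    moreover have "dist v (T y) \<le> dist v y + D y" by (rule dist_triangle)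
    then have "\<alpha> * dist v (T y) \<le> \<alpha> * (dist v y + D y)" using \<alpha> by (intro mult_left_mono) auto
    moreover have "\<alpha> * D y \<le> 1 * D y" using \<alpha> by (intro mult_right_mono) auto
    ultimately have "(1 - \<alpha>) * dist (T v) y \<le> (1 - \<alpha>) * dist v y + 3 * \<zeta>1"
      using y(3) \<zeta>1(1) by (simp add: algebra_simps)
    then have "dist (T v) y \<le> dist v y + K * \<zeta>1" using \<alpha> by (simp add: K_def field_simps)
    then have "dist (T v) y \<le> \<rho> + 2 * \<epsilon>" using y(5) \<zeta>1 by linarith
    then have "dist m y < d"
      using m y(5) \<epsilon> by (intro near[of "\<rho> + 2 * \<epsilon>" v m y "T v" "\<rho> + 2 * \<epsilon>"]) (auto simp: \<rho>_def)
    then show False using off_m[OF y(2)] by simp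
  qed
  define \<sigma> where "\<sigma> = min \<epsilon> (\<rho> - dist v p)"
  have \<sigma>: "0 < \<sigma>" using \<epsilon> \<rho> by (simp add: \<sigma>_def)
  from almost_fixed_on_segment[OF \<sigma> \<zeta>1(1), of R] obtain \<zeta>2 where \<zeta>2: "0 < \<zeta>2"
    and seg: "\<forall>l u p t. l \<in> C \<longrightarrow> u \<in> C \<longrightarrow> p \<in> F \<longrightarrow> l \<le> u \<longrightarrow> u \<le> p \<longrightarrow> D l \<le> \<zeta>2 \<longrightarrow> dist u p \<le> \<zeta>2 \<longrightarrow>
      0 \<le> t \<longrightarrow> t \<le> 1 \<longrightarrow> \<sigma> \<le> dist l (H l u t) \<longrightarrow> dist l (H l u t) \<le> R \<longrightarrow> \<sigma> \<le> dist (H l u t) u \<longrightarrow>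
      D (H l u t) < \<zeta>1"
    by blast
  have "2 * dist v y < D v"
    if y: "y \<in> C" "T v \<le> y" "y \<le> p" "D y \<le> min \<zeta>1 \<zeta>2" "dist y p \<le> R" for y
  proof (rule ccontr)
    assume "\<not> 2 * dist v y < D v"
    then have far: "\<rho> \<le> dist v y" by (simp add: \<rho>_def)
    show False
    proof (cases "dist v y \<le> \<rho> + \<epsilon>")
      case True
      then show False using no_shell[of y] y far by simp
    next
      case False
      obtain s where s: "0 \<le> s" "s \<le> 1" "dist v (H p y s) = \<rho>"
        using segment_point_at_dist[OF \<rho>(1) far] by blast
      define V where "V = H y p (1 - s)"
      have V: "dist v V = \<rho>" using s H_commute[of s p y] by (simp add: V_def)
      have pC: "p \<in> C" using p F_D by blast
      have VC: "V \<in> C" "y \<le> V"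
        unfolding V_def using H_mem[OF y(1) pC, of "1 - s"] H_between(1)[OF y(3), of "1 - s"] s by auto
      have 1: "\<sigma> \<le> dist y V"
        using dist_triangle[of v y V] V False by (simp add: \<sigma>_def dist_commute)
      have 2: "\<sigma> \<le> dist V p" using dist_triangle[of v V p] V by (simp add: \<sigma>_def dist_commute)
      have "dist y V \<le> dist y p"
        using dist_H_left(1)[of "1 - s" y p] mult_left_le_one_le[of "dist y p" "1 - s"] s by (simp add: V_def)
      then have "D V < \<zeta>1"
        using seg[rule_format, of y p p "1 - s"] y pC p(1) F_D(2)[OF p(1)] 1 2 s \<zeta>2 by (simp add: V_def)
      moreover have "T v \<le> V" using y(2) VC(2) by (rule order_trans)
      ultimately show False using no_shell[of V] VC V \<epsilon> by simp
    qed
  qed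
  then show ?thesis using \<zeta>1 \<zeta>2 by (intro exI[of _ "min \<zeta>1 \<zeta>2"]) auto
qed

text \<open>
  The points near \<^term>\<open>u\<close> of the segment from an almost fixed point \<^term>\<open>l\<close> to \<^term>\<open>u\<close> are almost
  fixed, and so they control the position of \<^term>\<open>T u\<close>. A short segment has no room for such points, but
  then \<^term>\<open>l\<close> itself serves.
\<close>

lemma small_displacement_near_fixed:
  assumes \<eta>: "0 < \<eta>"
  shows "\<exists>\<zeta>>0. \<forall>l u p. l \<in> C \<longrightarrow> u \<in> C \<longrightarrow> p \<in> F \<longrightarrow> l \<le> T l \<longrightarrow> T l \<le> u \<longrightarrow> u \<le> p \<longrightarrow> D l \<le> \<zeta> \<longrightarrow>
    dist u p \<le> \<zeta> \<longrightarrow> dist l u \<le> R \<longrightarrow> D u \<le> \<eta>"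
proof -
  define \<sigma> where "\<sigma> = \<eta> / 8"
  have \<sigma>: "0 < \<sigma>" "0 < \<sigma> / K" using \<eta> K_ge by (auto simp: \<sigma>_def)
  have K\<sigma>: "K * (\<sigma> / K) = \<sigma>" using K_ge by simp
  have "3 * (\<sigma> / K) \<le> K * (\<sigma> / K)" using \<sigma> K_ge by (intro mult_right_mono) auto
  then have \<sigma>K: "\<sigma> / K \<le> \<sigma>" using \<sigma> K\<sigma> by linarith
  from almost_fixed_on_segment[OF \<sigma>, of R] obtain \<zeta>0 where \<zeta>0: "0 < \<zeta>0"
    and seg: "\<forall>l u p t. l \<in> C \<longrightarrow> u \<in> C \<longrightarrow> p \<in> F \<longrightarrow> l \<le> u \<longrightarrow> u \<le> p \<longrightarrow> D l \<le> \<zeta>0 \<longrightarrow> dist u p \<le> \<zeta>0 \<longrightarrow>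
      0 \<le> t \<longrightarrow> t \<le> 1 \<longrightarrow> \<sigma> \<le> dist l (H l u t) \<longrightarrow> dist l (H l u t) \<le> R \<longrightarrow> \<sigma> \<le> dist (H l u t) u \<longrightarrow>
      D (H l u t) < \<sigma> / K"
    by blast
  define \<zeta> where "\<zeta> = min \<zeta>0 (\<sigma> / K)"
  have \<zeta>: "0 < \<zeta>" "\<zeta> \<le> \<zeta>0" "\<zeta> \<le> \<sigma> / K" using \<zeta>0 \<sigma> by (auto simp: \<zeta>_def)
  have "D u \<le> \<eta>"
    if h: "l \<in> C" "u \<in> C" "p \<in> F" "l \<le> T l" "T l \<le> u" "u \<le> p" "D l \<le> \<zeta>" "dist u p \<le> \<zeta>" "dist l u \<le> R"
    for l u p
  proof -
    have lu: "l \<le> u" using h(4,5) by (rule order_trans)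
    show ?thesis
    proof (cases "dist l u < 2 * \<sigma>")
      case True
      have "dist l (T u) \<le> dist l u + K * D l"
        using dist_T_le_of_displacement[OF h(1,2) lu] h(4,5) by simp
      moreover have "K * D l \<le> K * (\<sigma> / K)" using h(7) \<zeta> K_ge by (intro mult_left_mono) auto
      moreover have "D u \<le> dist l u + dist l (T u)" by (rule dist_triangle3)
      ultimately show ?thesis using True K\<sigma> \<sigma> unfolding \<sigma>_def by linarith
    next
      case False
      define r where "r = dist l u"
      have r: "2 * \<sigma> \<le> r" "0 < r" using False \<sigma> by (auto simp: r_def)
      define t where "t = 1 - \<sigma> / r"
      have t: "0 \<le> t" "t \<le> 1" "t * r = r - \<sigma>" using r \<sigma> by (auto simp: t_def field_simps)
      define V where "V = H l u t"
      have lV: "dist l V = r - \<sigma>" using dist_H_left(1)[OF t(1,2), of l u] t(3) by (simp add: V_def r_def)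
      have Vu: "dist V u = \<sigma>"
        using dist_H_left(2)[OF t(1,2), of u l] t(3) by (simp add: V_def r_def dist_commute algebra_simps)
      have DV: "D V < \<sigma> / K"
        using seg[rule_format, OF h(1-3) lu h(6) _ _ t(1,2)] h(7-9) \<zeta> lV Vu r \<sigma>
        by (simp add: V_def[symmetric] r_def[symmetric])
      have VC: "V \<in> C" "V \<le> u"
        unfolding V_def using H_mem[OF h(1,2) t(1,2)] H_between[OF lu t(1,2)] by auto
      have "D V \<le> 2 * dist V u" using DV Vu \<sigma>K \<sigma> by linarith
      then have "dist V (T u) \<le> dist V u + K * D V"
        using dist_T_le_of_displacement[OF VC(1) h(2) VC(2)] by simp
      moreover have "K * D V \<le> K * (\<sigma> / K)" using DV K_ge by (intro mult_left_mono) auto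
      moreover have "D u \<le> dist V u + dist V (T u)" by (rule dist_triangle3)
      ultimately show ?thesis using Vu K\<sigma> \<sigma> unfolding \<sigma>_def by linarith
    qed
  qed
  then show ?thesis using \<zeta>(1) by blast
qed

end

section \<open>The iteration from below\<close>

locale increasing_iteration = monotone_nonexpansive_map H C T \<alpha>
  for H :: "'a::{complete_space,order} \<Rightarrow> 'a \<Rightarrow> real \<Rightarrow> 'a" and C T \<alpha> +
  fixes a b c :: "nat \<Rightarrow> real" and x y z :: "nat \<Rightarrow> 'a"
  assumes a01: "0 \<le> a n" "a n \<le> 1" and b01: "0 \<le> b n" "b n \<le> 1" and c01: "0 \<le> c n" "c n \<le> 1"
    and z_eq: "z n = H (x n) (T (x n)) (c n)"
    and y_eq: "y n = H (z n) (T (z n)) (b n)"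
    and x_Suc: "x (Suc n) = H (T (z n)) (T (y n)) (a n)"
    and x0: "x 0 \<in> C" "x 0 \<le> T (x 0)" "p \<in> F \<Longrightarrow> x 0 \<le> p"
    and F_ne: "F \<noteq> {}"
begin

lemma averaged_point:
  assumes "u \<in> C" "u \<le> T u" "0 \<le> t" "t \<le> 1"
  shows "H u (T u) t \<in> C" "u \<le> H u (T u) t" "H u (T u) t \<le> T u" "T u \<le> T (H u (T u) t)"
proof -
  show mem: "H u (T u) t \<in> C" using assms T_mem by (intro H_mem) auto
  show le: "u \<le> H u (T u) t" "H u (T u) t \<le> T u" using H_between[OF assms(2-4)] by auto
  show "T u \<le> T (H u (T u) t)" using assms(1) mem le(1) by (rule T_mono)
qed

text \<open>
  The three points of a step and their images form a chain. The relation \<^prop>\<open>x n \<le> T (x n)\<close> starts the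
  chain of each step and follows from the chain of the step before, so all relations are proved together.
\<close>

lemma x_in: "x n \<in> C \<and> x n \<le> T (x n)"
  and z_in: "z n \<in> C \<and> x n \<le> z n \<and> z n \<le> T (x n) \<and> T (x n) \<le> T (z n)"
  and y_in: "y n \<in> C \<and> z n \<le> y n \<and> y n \<le> T (z n) \<and> T (z n) \<le> T (y n)"
  and x_Suc_in: "T (z n) \<le> x (Suc n) \<and> x (Suc n) \<le> T (y n)"
proof -
  have step: "(z n \<in> C \<and> x n \<le> z n \<and> z n \<le> T (x n) \<and> T (x n) \<le> T (z n)) \<and>
      (y n \<in> C \<and> z n \<le> y n \<and> y n \<le> T (z n) \<and> T (z n) \<le> T (y n)) \<and>
      (T (z n) \<le> x (Suc n) \<and> x (Suc n) \<le> T (y n)) \<and> (x (Suc n) \<in> C \<and> x (Suc n) \<le> T (x (Suc n)))"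
    if h: "x n \<in> C" "x n \<le> T (x n)" for n
  proof -
    have z: "z n \<in> C" "x n \<le> z n" "z n \<le> T (x n)" "T (x n) \<le> T (z n)"
      unfolding z_eq using averaged_point[OF h c01] by auto
    have "z n \<le> T (z n)" using z(3,4) by (rule order_trans)
    then have y: "y n \<in> C" "z n \<le> y n" "y n \<le> T (z n)" "T (z n) \<le> T (y n)"
      unfolding y_eq[of n] using averaged_point[OF z(1) _ b01] by auto
    have x: "T (z n) \<le> x (Suc n)" "x (Suc n) \<le> T (y n)"
      unfolding x_Suc using H_between[OF y(4) a01] by auto
    have xC: "x (Suc n) \<in> C" unfolding x_Suc using z(1) y(1) T_mem a01 by (intro H_mem) auto
    have "y n \<le> x (Suc n)" using y(3) x(1) by (rule order_trans)
    then have "T (y n) \<le> T (x (Suc n))" using y(1) xC by (intro T_mono)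
    then have "x (Suc n) \<le> T (x (Suc n))" using x(2) by (rule order_trans[rotated])
    then show ?thesis using z y x xC by blast
  qed
  have all: "x n \<in> C \<and> x n \<le> T (x n)" for n
  proof (induction n)
    case 0 then show ?case using x0 by simp
  next
    case (Suc n) then show ?case using step by blast
  qed
  show "x n \<in> C \<and> x n \<le> T (x n)" by (rule all)
  show "z n \<in> C \<and> x n \<le> z n \<and> z n \<le> T (x n) \<and> T (x n) \<le> T (z n)"
    "y n \<in> C \<and> z n \<le> y n \<and> y n \<le> T (z n) \<and> T (z n) \<le> T (y n)"
    "T (z n) \<le> x (Suc n) \<and> x (Suc n) \<le> T (y n)"
    using step all by blast+
qed

lemma pts_C: "x n \<in> C" "z n \<in> C" "y n \<in> C"
  using x_in z_in y_in by auto

lemma z_le_T: "z n \<le> T (z n)"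
  using z_in[of n] by (meson order_trans)

lemma y_le_T: "y n \<le> T (y n)"
  using y_in[of n] by (meson order_trans)

lemma x_le_z: "x n \<le> z n" and z_le_y: "z n \<le> y n" and x_le_y: "x n \<le> y n"
  using z_in[of n] y_in[of n] by (auto intro: order_trans)

lemma Tz_le_x_Suc: "T (z n) \<le> x (Suc n)"
  using x_Suc_in by blast

lemma Tx_le_x_Suc: "T (x n) \<le> x (Suc n)"
  using z_in[of n] Tz_le_x_Suc[of n] by (meson order_trans)

lemma y_le_x_Suc: "y n \<le> x (Suc n)"
  using y_in[of n] Tz_le_x_Suc[of n] by (meson order_trans)

lemma Ty_le_x: "T (y n) \<le> x (Suc (Suc n))"
  using T_mono[OF pts_C(3) pts_C(1) y_le_x_Suc[of n]] Tx_le_x_Suc[of "Suc n"] by (rule order_trans)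

lemma Tz_le_x: "T (z n) \<le> x (Suc (Suc n))"
  using y_in[of n] Ty_le_x[of n] by (meson order_trans)

lemma x_mono: "m \<le> n \<Longrightarrow> x m \<le> x n"
proof (rule lift_Suc_mono_le[of x])
  show "x n \<le> x (Suc n)" for n using x_in[of n] Tx_le_x_Suc[of n] by (meson order_trans)
qed

lemma below_fixed:
  assumes "p \<in> F"
  shows "x n \<le> p" "z n \<le> p" "y n \<le> p" "T (x n) \<le> p" "T (z n) \<le> p" "T (y n) \<le> p"
proof -
  have pC: "p \<in> C" "T p = p" using F_D assms by auto
  have T_le: "T u \<le> p" if "u \<in> C" "u \<le> p" for u using T_mono[OF that(1) pC(1) that(2)] pC(2) by simp
  have x: "x n \<le> p" for n
  proof (induction n)
    case 0 then show ?case using x0 assms by simp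
  next
    case (Suc n)
    have "z n \<le> p" using z_in[of n] T_le[OF pts_C(1) Suc] by (meson order_trans)
    then have "y n \<le> p" using y_in[of n] T_le[OF pts_C(2)] by (meson order_trans)
    then show ?case using x_Suc_in[of n] T_le[OF pts_C(3)] by (meson order_trans)
  qed
  show "x n \<le> p" by (rule x)
  show Tx: "T (x n) \<le> p" using T_le[OF pts_C(1) x] .
  show z: "z n \<le> p" using z_in[of n] Tx by (meson order_trans)
  show Tz: "T (z n) \<le> p" using T_le[OF pts_C(2) z] .
  show y: "y n \<le> p" using y_in[of n] Tz by (meson order_trans)
  show "T (y n) \<le> p" using T_le[OF pts_C(3) y] .
qed

text \<open>
  The points of a step at which \<^term>\<open>T\<close> is evaluated.
\<close>

abbreviation pts :: "nat \<Rightarrow> 'a set" where "pts n \<equiv> {x n, z n, y n}"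

lemma pts_facts:
  assumes "v \<in> pts n"
  shows "v \<in> C" "v \<le> T v" "x n \<le> v" "T v \<le> x (Suc (Suc n))" "p \<in> F \<Longrightarrow> v \<le> p" "p \<in> F \<Longrightarrow> T v \<le> p"
proof -
  have "T (x n) \<le> x (Suc (Suc n))"
    using Tx_le_x_Suc[of n] x_mono[of "Suc n" "Suc (Suc n)"] by (meson order_trans le_SucI order_refl)
  then show "v \<in> C" "v \<le> T v" "x n \<le> v" "T v \<le> x (Suc (Suc n))" "p \<in> F \<Longrightarrow> v \<le> p" "p \<in> F \<Longrightarrow> T v \<le> p"
    using assms pts_C x_in z_le_T y_le_T x_le_z x_le_y Tz_le_x Ty_le_x below_fixed by auto
qed

lemma radius_step:
  assumes "dist (x n) p \<le> r" and T: "\<And>v. v \<in> pts n \<Longrightarrow> dist v p \<le> r \<Longrightarrow> dist (T v) p \<le> r"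
  shows "dist (z n) p \<le> r" "dist (y n) p \<le> r" "dist (x (Suc n)) p \<le> r"
    "dist (T (x n)) p \<le> r" "dist (T (z n)) p \<le> r" "dist (T (y n)) p \<le> r"
proof -
  show Tx: "dist (T (x n)) p \<le> r" using T assms(1) by simp
  show z: "dist (z n) p \<le> r"
    using dist_H_ball[OF c01, of p "x n" r "T (x n)" n] Tx assms(1) by (simp add: z_eq dist_commute)
  show Tz: "dist (T (z n)) p \<le> r" using T z by simp
  show y: "dist (y n) p \<le> r"
    using dist_H_ball[OF b01, of p "z n" r "T (z n)" n] z Tz by (simp add: y_eq[of n] dist_commute)
  show Ty: "dist (T (y n)) p \<le> r" using T y by simp
  show "dist (x (Suc n)) p \<le> r"
    using dist_H_ball[OF a01, of p "T (z n)" r "T (y n)" n] Tz Ty by (simp add: x_Suc dist_commute)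
qed

lemma dist_antimono_if_good:
  assumes p: "p \<in> F" and good: "\<And>n v. N \<le> n \<Longrightarrow> v \<in> pts n \<Longrightarrow> D v \<le> 2 * dist v p"
    and "N \<le> m" "m \<le> n"
  shows "dist (x n) p \<le> dist (x m) p"
proof -
  have "dist (x (Suc k)) p \<le> dist (x k) p" if "N \<le> k" for k
  proof (rule radius_step)
    fix v assume v: "v \<in> pts k" "dist v p \<le> dist (x k) p"
    have "dist (T v) p \<le> dist v p"
      using pts_facts[OF v(1)] p good[OF that v(1)] by (intro quasi_nonexpansive) auto
    then show "dist (T v) p \<le> dist (x k) p" using v(2) by linarith
  qed simp
  then have "dist (x (m + k)) p \<le> dist (x m) p" for k
  proof (induction k)
    case (Suc k) then show ?case using assms(3) by (metis add_Suc_right le_add1 order_trans)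
  qed simp
  from this[of "n - m"] show ?thesis using assms(4) by simp
qed

text \<open>
  Each step of the iteration applies \<^term>\<open>T\<close> at least once, so it overtakes the asymptotically regular
  sequence that starts at one of the iterates.
\<close>

lemma reg_le_x: "reg (x m) i \<le> x (m + i) \<and> T (reg (x m) i) \<le> x (Suc (m + i))"
proof (induction i)
  case 0 then show ?case using Tx_le_x_Suc by simp
next
  case (Suc i)
  have r: "reg (x m) (Suc i) \<in> C" using reg_below x_in by blast
  have "reg (x m) (Suc i) \<le> T (reg (x m) i)" using reg_step(2) x_in by blast
  then have le: "reg (x m) (Suc i) \<le> x (m + Suc i)" using Suc by (simp add: order_trans)
  have "T (reg (x m) (Suc i)) \<le> T (x (m + Suc i))" using r pts_C(1) le by (rule T_mono)
  also have "\<dots> \<le> x (Suc (m + Suc i))" by (rule Tx_le_x_Suc)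
  finally show ?case using le by blast
qed

lemma D_reg_x_small:
  assumes "0 < \<epsilon>"
  shows "\<exists>i. D (reg (x m) i) \<le> \<epsilon>"
proof -
  obtain p where p: "p \<in> F" using F_ne by blast
  have x: "x m \<in> C" "x m \<le> T (x m)" using x_in by auto
  have "(\<lambda>n. D (reg (x m) n)) \<longlonglongrightarrow> 0"
    using reg_bounded[OF x p below_fixed(1)[OF p]] by (intro D_reg_tendsto_0[OF x])
  then have "eventually (\<lambda>n. D (reg (x m) n) < \<epsilon>) sequentially" using assms by (rule order_tendstoD)
  then obtain i where "D (reg (x m) i) < \<epsilon>" using eventually_happens'[OF sequentially_bot] by blast
  then show ?thesis by (intro exI[of _ i]) simp
qed

text \<open>
  Without bad points the distances to all fixed points decrease. Then closeness to one fixed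
  point persists, so the iterates form a Cauchy sequence. The limit is fixed because the iterates,
  which are not bad, have displacements that tend to zero along a subsequence.
\<close>

lemma convergence_if_good:
  assumes near: "\<And>\<eta> N. 0 < \<eta> \<Longrightarrow> \<exists>n\<ge>N. \<exists>p\<in>F. dist (x n) p < \<eta>"
    and good: "\<And>n v p. N \<le> n \<Longrightarrow> v \<in> pts n \<Longrightarrow> p \<in> F \<Longrightarrow> D v \<le> 2 * dist v p"
  shows "\<exists>q\<in>F. x \<longlonglongrightarrow> q"
proof -
  have anti: "dist (x n) p \<le> dist (x m) p" if "p \<in> F" "N \<le> m" "m \<le> n" for p m n
    using dist_antimono_if_good[OF that(1) _ that(2,3)] good that(1) by blast
  have "Cauchy x"
  proof (rule metric_CauchyI)
    fix \<eta> :: real assume "0 < \<eta>"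
    then obtain m p where m: "m \<ge> N" "p \<in> F" "dist (x m) p < \<eta> / 2" using near[of "\<eta> / 2" N] by auto
    have "dist (x i) (x j) < \<eta>" if "i \<ge> m" "j \<ge> m" for i j
      using anti[OF m(2,1) that(1)] anti[OF m(2,1) that(2)] m(3) dist_triangle2[of "x i" "x j" p] by linarith
    then show "\<exists>M. \<forall>i\<ge>M. \<forall>j\<ge>M. dist (x i) (x j) < \<eta>" by blast
  qed
  then obtain q where q: "x \<longlonglongrightarrow> q" using Cauchy_convergent convergent_def by blast
  have qC: "q \<in> C" using closed_sequentially[OF C_closed _ q] pts_C(1) by blast
  have xq: "x n \<le> q" for n
    by (rule limit_ge[OF LIMSEQ_ignore_initial_segment[OF q, of n]]) (simp add: x_mono)
  have "D q \<le> \<epsilon>" if "0 < \<epsilon>" for \<epsilon>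
  proof -
    define \<eta> where "\<eta> = \<epsilon> / (2 + 2 * K)"
    have \<eta>: "0 < \<eta>" "\<eta> * (2 + 2 * K) = \<epsilon>" using that K_ge by (auto simp: \<eta>_def)
    obtain M where M: "\<And>n. n \<ge> M \<Longrightarrow> dist (x n) q < \<eta>" using q \<eta>(1) unfolding lim_sequentially by blast
    obtain n p where n: "n \<ge> max N M" "p \<in> F" "dist (x n) p < \<eta>" using near[OF \<eta>(1)] by blast
    have "D (x n) \<le> 2 * dist (x n) p" using good[of n "x n" p] n by simp
    then have "K * D (x n) \<le> K * (2 * \<eta>)" using n(3) K_ge by (intro mult_left_mono) auto
    moreover have "dist (x n) (T q) \<le> dist (x n) q + K * D (x n)"
      using x_in[of n] qC xq[of n] order_trans[OF Tx_le_x_Suc[of n] xq[of "Suc n"]]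
      by (intro dist_T_le_of_displacement) auto
    moreover have "D q \<le> dist (x n) q + dist (x n) (T q)" by (rule dist_triangle3)
    moreover have "dist (x n) q < \<eta>" using M n by simp
    ultimately have "D q \<le> 2 * \<eta> + K * (2 * \<eta>)" by linarith
    then show ?thesis using \<eta>(2) by (simp add: algebra_simps)
  qed
  then have "D q \<le> 0" by (rule field_le_epsilon[of _ 0, simplified])
  then have "q \<in> F" using qC by (simp add: fixed_points_def)
  then show ?thesis using q by blast
qed

text \<open>
  Let \<^term>\<open>v\<close> be bad for \<^term>\<open>p0\<close>, so that a ball around \<^term>\<open>v\<close> contains all almost fixed points
  between \<^term>\<open>T v\<close> and \<^term>\<open>p0\<close> that are not too far away. If the iterates were close to fixed points only
  far away from \<^term>\<open>p0\<close>, then a segment from an almost fixed point to such an iterate would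
  contain almost fixed points at any prescribed distance, in particular outside of this ball.
\<close>

lemma near_fixed_points_bounded:
  assumes near: "\<And>\<eta> N. 0 < \<eta> \<Longrightarrow> \<exists>n\<ge>N. \<exists>p\<in>F. dist (x n) p < \<eta>"
    and v: "v \<in> C" "v \<le> T v" "T v \<le> x m" and p0: "p0 \<in> F" and bad: "2 * dist v p0 < D v"
  shows "\<exists>R. \<forall>\<eta>>0. \<forall>N. \<exists>n\<ge>N. \<exists>p\<in>F. dist (x n) p < \<eta> \<and> dist (x n) p0 \<le> R"
proof (rule ccontr)
  define B where "B = max (dist (x m) p0) (3 / 2 * D (x m))"
  (* the distance from l at which V is chosen below; it puts V outside of the ball *)
  define r0 where "r0 = D v + dist v p0 + B + 1"
  have xm: "x m \<in> C" "x m \<le> T (x m)" using x_in by auto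
  have L: "dist (reg (x m) i) p0 \<le> B" for i
    using reg_bounded(3)[OF xm p0 below_fixed(1)[OF p0]] by (simp add: B_def)
  have B: "0 \<le> B" by (simp add: B_def le_max_iff_disj)
  then have r0: "1 \<le> r0" by (simp add: r0_def)
  have "v \<le> p0" using v(2) order_trans[OF v(3) below_fixed(1)[OF p0]] by (rule order_trans)
  from almost_fixed_in_ball[OF v(1,2) p0 this bad, of "r0 + B"] obtain \<zeta> where \<zeta>: "0 < \<zeta>"
    and ball: "\<forall>y\<in>C. T v \<le> y \<longrightarrow> y \<le> p0 \<longrightarrow> D y \<le> \<zeta> \<longrightarrow> dist y p0 \<le> r0 + B \<longrightarrow> 2 * dist v y < D v"
    by blast
  have one: "(0::real) < 1" by simp
  from almost_fixed_on_segment[OF one \<zeta>, of r0] obtain \<zeta>' where \<zeta>': "0 < \<zeta>'"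
    and seg: "\<forall>l u p t. l \<in> C \<longrightarrow> u \<in> C \<longrightarrow> p \<in> F \<longrightarrow> l \<le> u \<longrightarrow> u \<le> p \<longrightarrow> D l \<le> \<zeta>' \<longrightarrow> dist u p \<le> \<zeta>' \<longrightarrow>
      0 \<le> t \<longrightarrow> t \<le> 1 \<longrightarrow> 1 \<le> dist l (H l u t) \<longrightarrow> dist l (H l u t) \<le> r0 \<longrightarrow> 1 \<le> dist (H l u t) u \<longrightarrow>
      D (H l u t) < \<zeta>"
    by blast
  assume "\<nexists>R. \<forall>\<eta>>0. \<forall>N. \<exists>n\<ge>N. \<exists>p\<in>F. dist (x n) p < \<eta> \<and> dist (x n) p0 \<le> R"
  then obtain \<eta>0 N where \<eta>0: "0 < \<eta>0"
    and far: "\<And>n p. n \<ge> N \<Longrightarrow> p \<in> F \<Longrightarrow> dist (x n) p < \<eta>0 \<Longrightarrow> r0 + 1 + B < dist (x n) p0"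
    by (meson not_le)
  obtain i where i: "D (reg (x m) i) \<le> \<zeta>'" using D_reg_x_small[OF \<zeta>'] by blast
  define l where "l = reg (x m) i"
  have "0 < min \<eta>0 \<zeta>'" using \<eta>0 \<zeta>' by simp
  then obtain n p where n: "n \<ge> max N (m + i)" "p \<in> F" "dist (x n) p < min \<eta>0 \<zeta>'" using near by blast
  have "r0 + 1 + B < dist (x n) p0" using far[of n p] n by simp
  moreover have "dist (x n) p0 \<le> dist l (x n) + dist l p0" by (rule dist_triangle3)
  ultimately have r: "r0 + 1 < dist l (x n)" using L[of i] by (simp add: l_def)
  define t where "t = r0 / dist l (x n)"
  have "r0 \<le> dist l (x n)" "0 < dist l (x n)" using r r0 by linarith+
  then have t: "0 \<le> t" "t \<le> 1" "t * dist l (x n) = r0" using r0 by (auto simp: t_def divide_le_eq_1)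
  have lC: "l \<in> C" using reg_below[OF xm] by (simp add: l_def)
  have lx: "l \<le> x n" using reg_le_x[of m i] x_mono[of "m + i" n] n(1) by (auto simp: l_def intro: order_trans)
  define V where "V = H l (x n) t"
  have lV: "dist l V = r0" using dist_H_left(1)[OF t(1,2), of l "x n"] t(3) by (simp add: V_def)
  have Vx: "dist V (x n) = dist l (x n) - r0"
    using dist_H_left(2)[OF t(1,2), of "x n" l] t(3) by (simp add: V_def dist_commute algebra_simps)
  have DV: "D V < \<zeta>"
    using seg[rule_format, OF lC pts_C(1) n(2) lx below_fixed(1)[OF n(2)] _ _ t(1,2)]
      i n(3) lV Vx r r0 by (simp add: V_def[symmetric] l_def[symmetric])
  have VC: "V \<in> C" "l \<le> V" "V \<le> x n"
    unfolding V_def using H_mem[OF lC pts_C(1) t(1,2)] H_between[OF lx t(1,2)] by auto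
  have "T v \<le> l"
    using v(3) reg_incseq(1)[OF xm, of 0 i] unfolding l_def reg.simps by (meson order_trans le0)
  then have "T v \<le> V" using VC(2) by (rule order_trans)
  moreover have "V \<le> p0" using VC(3) below_fixed(1)[OF p0] by (rule order_trans)
  moreover have "dist V p0 \<le> r0 + B"
    using dist_triangle3[of V p0 l] lV L[of i] by (simp add: l_def)
  ultimately have "2 * dist v V < D v" using ball VC(1) DV by simp
  moreover have "dist l V \<le> dist l p0 + dist v p0 + dist v V"
    using dist_triangle[of l V p0] dist_triangle[of p0 V v] by (simp add: dist_commute)
  moreover have "0 \<le> D v" by simp
  ultimately show False using lV L[of i] unfolding r0_def l_def by linarith
qed

text \<open>
  The almost fixed points of the sequence \<^term>\<open>reg (x 0)\<close> are bounded and below the late iterates, so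
  an iterate at bounded distance that is close to a fixed point has a small displacement.
\<close>

lemma small_displacement_subsequence:
  assumes near: "\<And>\<eta> N. 0 < \<eta> \<Longrightarrow> \<exists>n\<ge>N. \<exists>p\<in>F. dist (x n) p < \<eta> \<and> dist (x n) p0 \<le> R" and p0: "p0 \<in> F"
    and \<eta>: "0 < \<eta>"
  shows "\<exists>n\<ge>N. \<exists>p\<in>F. dist (x n) p \<le> \<eta> \<and> D (x n) \<le> \<eta>"
proof -
  define B where "B = max (dist (x 0) p0) (3 / 2 * D (x 0))"
  have x0': "x 0 \<in> C" "x 0 \<le> T (x 0)" using x_in by auto
  have L: "dist (reg (x 0) i) p0 \<le> B" for i
    using reg_bounded(3)[OF x0' p0 below_fixed(1)[OF p0]] by (simp add: B_def)
  from small_displacement_near_fixed[OF \<eta>, of "B + R"] obtain \<zeta> where \<zeta>: "0 < \<zeta>"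
    and small: "\<forall>l u p. l \<in> C \<longrightarrow> u \<in> C \<longrightarrow> p \<in> F \<longrightarrow> l \<le> T l \<longrightarrow> T l \<le> u \<longrightarrow> u \<le> p \<longrightarrow> D l \<le> \<zeta> \<longrightarrow>
      dist u p \<le> \<zeta> \<longrightarrow> dist l u \<le> B + R \<longrightarrow> D u \<le> \<eta>"
    by blast
  obtain i where i: "D (reg (x 0) i) \<le> \<zeta>" using D_reg_x_small[OF \<zeta>] by blast
  have "0 < min \<eta> \<zeta>" using \<eta> \<zeta> by simp
  then obtain n p where n: "n \<ge> max N (Suc i)" "p \<in> F" "dist (x n) p < min \<eta> \<zeta>" "dist (x n) p0 \<le> R"
    using near by blast
  have "T (reg (x 0) i) \<le> x n"
    using reg_le_x[of 0 i] x_mono[of "Suc i" n] n(1) by (auto intro: order_trans)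
  moreover have "dist (reg (x 0) i) (x n) \<le> B + R"
    using dist_triangle2[of "reg (x 0) i" "x n" p0] L[of i] n(4) by linarith
  ultimately have "D (x n) \<le> \<eta>"
    using small[rule_format, of "reg (x 0) i" "x n" p] reg_below[OF x0', of i] pts_C(1) n(2,3)
      below_fixed(1)[OF n(2)] i by simp
  then show ?thesis using n by (intro exI[of _ n] conjI bexI[of _ p]) auto
qed

text \<open>
  The sequence of almost fixed points that starts at an iterate close to a fixed point \<^term>\<open>p\<close> with
  small displacement stays close to \<^term>\<open>p\<close>. Its asymptotic centre is the least fixed point \<^term>\<open>e\<close>,
  so \<^term>\<open>p\<close> is close to \<^term>\<open>e\<close>, and the later iterates are above almost fixed points close
  to \<^term>\<open>e\<close>.
\<close>

lemma approach_to_least_fixed_point: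
  assumes small: "\<And>\<eta> N. 0 < \<eta> \<Longrightarrow> \<exists>n\<ge>N. \<exists>p\<in>F. dist (x n) p \<le> \<eta> \<and> D (x n) \<le> \<eta>"
  obtains e where "e \<in> F"
    "\<And>\<eta> N. 0 < \<eta> \<Longrightarrow> \<exists>n\<ge>N. dist (x n) e \<le> \<eta>"
    "\<And>\<eta>. 0 < \<eta> \<Longrightarrow> \<exists>N. \<forall>n\<ge>N. \<exists>l\<in>C. l \<le> T l \<and> T l \<le> x n \<and> dist l e \<le> \<eta> \<and> D l \<le> \<eta>"
proof -
  have x: "x n \<in> C" "x n \<le> T (x n)" for n using x_in by auto
  obtain e where e: "e \<in> F" "\<forall>p\<in>F. e \<le> p"
    using least_fixed_point_is_center[OF x F_ne below_fixed(1), of 0] by blast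
  have close: "dist p e \<le> 6 * \<eta>" if h: "0 < \<eta>" "p \<in> F" "dist (x n) p \<le> \<eta>" "D (x n) \<le> \<eta>" for \<eta> n p
  proof -
    define L where "L = reg (x n)"
    have B: "max (dist (x n) p) (3 / 2 * D (x n)) \<le> 3 / 2 * \<eta>" using h by auto
    obtain t where t: "t \<in> C" "\<forall>i. T (L i) \<le> t" "\<forall>p\<in>F. t \<le> p" "dist p t \<le> 3 / 2 * \<eta>"
      using upper_bound_below_fixed_points[OF x below_fixed(1) h(2), of n] B unfolding L_def
      by (meson order_trans)
    have Lp: "dist (L i) p \<le> 3 / 2 * \<eta>" for i
      using reg_bounded(3)[OF x h(2) below_fixed(1)[OF h(2)], of n i] B unfolding L_def by linarith
    have "dist (L i) t \<le> 3 * \<eta>" for i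
      using dist_triangle[of "L i" t p] Lp[of i] t(4) by linarith
    then have ev: "eventually (\<lambda>i. dist (L i) t \<le> 3 * \<eta>) sequentially" by simp
    obtain e' where e': "e' \<in> F" "\<forall>p\<in>F. e' \<le> p"
      and cen: "\<forall>t\<in>C. \<forall>b b'. (\<forall>i. T (L i) \<le> t) \<longrightarrow> (\<forall>p\<in>F. t \<le> p) \<longrightarrow>
       eventually (\<lambda>i. dist (L i) t \<le> b) sequentially \<longrightarrow> b < b' \<longrightarrow>
       eventually (\<lambda>i. dist (L i) e' \<le> b') sequentially"
      using least_fixed_point_is_center[OF x F_ne below_fixed(1), of n] unfolding L_def by blast
    have "e' = e" using e e' by (intro order_antisym) auto
    have "eventually (\<lambda>i. dist (L i) e' \<le> 4 * \<eta>) sequentially"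
      using cen[rule_format, OF t(1) _ _ ev] t(2,3) h(1) by simp
    then obtain i where "dist (L i) e' \<le> 4 * \<eta>"
      using eventually_happens'[OF sequentially_bot] by blast
    then show ?thesis
      using dist_triangle3[of p e "L i"] Lp[of i] h(1) \<open>e' = e\<close> by simp
  qed
  show ?thesis
  proof (rule that[OF e(1)])
    show "\<exists>n\<ge>N. dist (x n) e \<le> \<eta>" if \<eta>: "0 < \<eta>" for \<eta> N
    proof -
      have "0 < \<eta> / 7" using \<eta> by simp
      then obtain n p where n: "n \<ge> N" "p \<in> F" "dist (x n) p \<le> \<eta> / 7" "D (x n) \<le> \<eta> / 7"
        using small by blast
      have "dist p e \<le> 6 * (\<eta> / 7)" using close[of "\<eta> / 7" p n] n \<eta> by simp
      then have "dist (x n) e \<le> \<eta>" using dist_triangle[of "x n" e p] n(3) by linarith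
      then show ?thesis using n(1) by blast
    qed
    show "\<exists>N. \<forall>n\<ge>N. \<exists>l\<in>C. l \<le> T l \<and> T l \<le> x n \<and> dist l e \<le> \<eta> \<and> D l \<le> \<eta>" if \<eta>: "0 < \<eta>" for \<eta>
    proof -
      have "0 < \<eta> / 8" using \<eta> by simp
      then obtain m p where m: "p \<in> F" "dist (x m) p \<le> \<eta> / 8" "D (x m) \<le> \<eta> / 8"
        using small by blast
      have pe: "dist p e \<le> 6 * (\<eta> / 8)" using close[of "\<eta> / 8" p m] m \<eta> by simp
      have "\<exists>l\<in>C. l \<le> T l \<and> T l \<le> x n \<and> dist l e \<le> \<eta> \<and> D l \<le> \<eta>" if n: "n \<ge> Suc m" for n
      proof (intro bexI[of _ "reg (x m) (n - Suc m)"] conjI)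
        let ?l = "reg (x m) (n - Suc m)"
        show "?l \<in> C" "?l \<le> T ?l" using reg_below[OF x] by auto
        show "T ?l \<le> x n" using reg_le_x[of m "n - Suc m"] n by simp
        have "dist ?l p \<le> 3 / 2 * (\<eta> / 8)"
          using reg_bounded(3)[OF x m(1) below_fixed(1)[OF m(1)], of m "n - Suc m"] m \<eta> by auto
        then show "dist ?l e \<le> \<eta>" using dist_triangle[of ?l e p] pe \<eta> by linarith
        show "D ?l \<le> \<eta>" using D_reg_antimono[OF x, of 0 "n - Suc m" m] m \<eta> by simp
      qed
      then show ?thesis by blast
    qed
  qed
qed

end

section \<open>Iterates that approach the least fixed point\<close>

locale approaching_iteration = increasing_iteration H C T \<alpha> a b c x y z
  for H :: "'a::{complete_space,order} \<Rightarrow> 'a \<Rightarrow> real \<Rightarrow> 'a" and C T \<alpha> a b c x y z +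
  fixes e :: 'a
  assumes e: "e \<in> F"
    and x_near_e: "0 < \<eta> \<Longrightarrow> \<exists>n\<ge>N. dist (x n) e \<le> \<eta>"
    and almost_fixed_below:
      "0 < \<eta> \<Longrightarrow> \<exists>N. \<forall>n\<ge>N. \<exists>l\<in>C. l \<le> T l \<and> T l \<le> x n \<and> dist l e \<le> \<eta> \<and> D l \<le> \<eta>"
begin

lemma e_C: "e \<in> C" and T_e: "T e = e"
  using F_D[OF e] by auto

lemma x_tendsto_e:
  assumes "\<And>\<eta>. 0 < \<eta> \<Longrightarrow> \<exists>N. \<forall>n\<ge>N. dist (x n) e \<le> \<eta>"
  shows "x \<longlonglongrightarrow> e"
proof (rule metric_LIMSEQ_I)
  fix r :: real assume r: "0 < r"
  then obtain N where "\<forall>n\<ge>N. dist (x n) e \<le> r / 2" using assms[of "r / 2"] by auto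
  then show "\<exists>N. \<forall>n\<ge>N. dist (x n) e < r" using r by (intro exI[of _ N]) (auto intro: le_less_trans)
qed

text \<open>
  Compare with an almost fixed point that is close to \<^term>\<open>e\<close> and below \<^term>\<open>v\<close>.
\<close>

lemma growth_bound:
  assumes \<omega>: "0 < \<omega>"
  shows "\<exists>N. \<forall>n\<ge>N. \<forall>v\<in>C. x n \<le> v \<longrightarrow> dist (T v) e \<le> dist v e + \<omega>"
proof -
  define \<eta> where "\<eta> = \<omega> / (K + 2)"
  have \<eta>: "0 < \<eta>" "\<eta> * (K + 2) = \<omega>" using \<omega> K_ge by (auto simp: \<eta>_def)
  obtain N where N: "\<forall>n\<ge>N. \<exists>l\<in>C. l \<le> T l \<and> T l \<le> x n \<and> dist l e \<le> \<eta> \<and> D l \<le> \<eta>"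
    using almost_fixed_below[OF \<eta>(1)] by blast
  have "dist (T v) e \<le> dist v e + \<omega>" if v: "n \<ge> N" "v \<in> C" "x n \<le> v" for n v
  proof -
    obtain l where l: "l \<in> C" "l \<le> T l" "T l \<le> x n" "dist l e \<le> \<eta>" "D l \<le> \<eta>" using N v(1) by blast
    have Tl: "T l \<le> v" using l(3) v(3) by (rule order_trans)
    have "dist l (T v) \<le> dist l v + K * D l"
      using l v Tl order_trans[OF l(2) Tl] by (intro dist_T_le_of_displacement) auto
    moreover have "K * D l \<le> K * \<eta>" using l(5) K_ge by (intro mult_left_mono) auto
    moreover have "dist (T v) e \<le> dist l (T v) + dist l e" by (rule dist_triangle3)
    moreover have "dist l v \<le> dist l e + dist v e" by (rule dist_triangle2)
    ultimately have "dist (T v) e \<le> dist v e + 2 * \<eta> + K * \<eta>" using l(4) by linarith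
    then show ?thesis using \<eta>(2) by (simp add: algebra_simps)
  qed
  then show ?thesis by blast
qed

section \<open>Trapping of the iterates for positive \<open>\<alpha>\<close>\<close>

text \<open>
  When \<^term>\<open>T s\<close> is close to \<^term>\<open>t\<close>, the terms that remain on the right of the defining inequality have
  the coefficients \<^term>\<open>\<alpha>\<close> and \<^term>\<open>1 - 2 * \<alpha>\<close>. Both distances are at most the diameter of the ball, up to
  \<^term>\<open>\<omega>\<close>, and a negative term can be dropped. This gives the factor \<^term>\<open>max \<alpha> (1 - \<alpha>)\<close>, which is less than
  one for positive \<^term>\<open>\<alpha>\<close>. If the premise of the inequality fails, \<^term>\<open>t\<close> is close to \<^term>\<open>s\<close>
  itself, and the displacement of \<^term>\<open>s\<close> is small.
\<close>

lemma displacement_near_image: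
  assumes s: "s \<in> C" "s \<le> T s" "dist s e \<le> r" and t: "t \<in> C" "s \<le> t" "dist t e \<le> r" "dist (T t) e \<le> r + \<omega>"
    and near: "dist (T s) t \<le> \<epsilon>" and \<omega>: "0 \<le> \<omega>"
  defines "M \<equiv> 2 * max \<alpha> (1 - \<alpha>) * r + \<omega> + (2 + 2 * K) * \<epsilon>"
  shows "T s \<le> t \<Longrightarrow> D t \<le> M" and "D t \<le> M \<or> dist s t \<le> \<epsilon>"
proof -
  have \<epsilon>: "0 \<le> \<epsilon>" using near by (meson order_trans zero_le_dist)
  have r: "0 \<le> r" using s(3) by (meson order_trans zero_le_dist)
  have K\<epsilon>: "0 \<le> K * \<epsilon>" using K_ge \<epsilon> by simp
  let ?\<beta> = "max \<alpha> (1 - \<alpha>)"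
  have regular: "D t \<le> M" if h: "D s \<le> 2 * dist s t"
  proof -
    have "dist (T s) (T t) \<le> \<alpha> * dist (T s) t + \<alpha> * dist s (T t) + (1 - 2 * \<alpha>) * dist s t"
      using nonexp s t h by blast
    moreover have "\<alpha> * dist (T s) t \<le> 1 * \<epsilon>" using \<alpha> near by (intro mult_mono) auto
    moreover have "\<alpha> * dist s (T t) + (1 - 2 * \<alpha>) * dist s t \<le> ?\<beta> * (2 * r) + \<omega> + K * \<epsilon>"
    proof (cases "\<alpha> \<le> 1 / 2")
      case True
      have sT: "dist s (T t) \<le> 2 * r + \<omega>" using dist_triangle2[of s "T t" e] s(3) t(4) by linarith
      have st: "dist s t \<le> 2 * r" using dist_triangle2[of s t e] s(3) t(3) by linarith
      have "\<alpha> * dist s (T t) + (1 - 2 * \<alpha>) * dist s t \<le> \<alpha> * (2 * r + \<omega>) + (1 - 2 * \<alpha>) * (2 * r)"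
        using sT st \<alpha> True by (intro add_mono mult_left_mono) auto
      also have "\<dots> = (1 - \<alpha>) * (2 * r) + \<alpha> * \<omega>" by (simp add: algebra_simps)
      also have "\<dots> \<le> ?\<beta> * (2 * r) + 1 * \<omega>" using \<alpha> \<omega> r by (intro add_mono mult_right_mono) auto
      finally show ?thesis using K\<epsilon> by linarith
    next
      case False
      have "dist s (T t) \<le> 2 * r + \<omega>" using dist_triangle2[of s "T t" e] s(3) t(4) by linarith
      then have "\<alpha> * dist s (T t) \<le> \<alpha> * (2 * r + \<omega>)" using \<alpha> by (intro mult_left_mono) auto
      also have "\<dots> = \<alpha> * (2 * r) + \<alpha> * \<omega>" by (simp add: algebra_simps)
      also have "\<dots> \<le> ?\<beta> * (2 * r) + 1 * \<omega>" using \<alpha> \<omega> r by (intro add_mono mult_right_mono) auto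
      finally have "\<alpha> * dist s (T t) \<le> ?\<beta> * (2 * r) + \<omega>" by simp
      moreover have "(1 - 2 * \<alpha>) * dist s t \<le> 0" using False by (simp add: mult_nonpos_nonneg)
      ultimately show ?thesis using K\<epsilon> by linarith
    qed
    moreover have "D t \<le> dist (T s) t + dist (T s) (T t)" by (rule dist_triangle3)
    ultimately have "D t \<le> 2 * \<epsilon> + ?\<beta> * (2 * r) + \<omega> + K * \<epsilon>" using near by linarith
    then show ?thesis using K\<epsilon> unfolding M_def by (simp add: algebra_simps)
  qed
  show "D t \<le> M \<or> dist s t \<le> \<epsilon>"
  proof (cases "D s \<le> 2 * dist s t")
    case False
    have "D s \<le> dist s t + dist (T s) t" by (rule dist_triangle2)
    then show ?thesis using False near by linarith
  qed (use regular in blast)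
  show "D t \<le> M" if Ts: "T s \<le> t"
  proof (cases "D s \<le> 2 * dist s t")
    case False
    have "D s \<le> dist s t + dist (T s) t" by (rule dist_triangle2)
    then have st: "dist s t \<le> \<epsilon>" "D s \<le> 2 * \<epsilon>" using False near by linarith+
    have "dist s (T t) \<le> dist s t + K * D s" using s t Ts by (intro dist_T_le_of_displacement) auto
    moreover have "K * D s \<le> K * (2 * \<epsilon>)" using st(2) K_ge by (intro mult_left_mono) auto
    moreover have "D t \<le> dist s t + dist s (T t)" by (rule dist_triangle3)
    ultimately have "D t \<le> (2 + 2 * K) * \<epsilon>" using st(1) by (simp add: algebra_simps)
    moreover have "0 \<le> 2 * ?\<beta> * r" using r \<alpha> by simp
    ultimately show ?thesis using \<omega> unfolding M_def by linarith
  qed (use regular in blast)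
qed

text \<open>
  A point \<^term>\<open>w\<close> of the segment from \<^term>\<open>u\<close> to \<^term>\<open>v\<close> that is almost as far from \<^term>\<open>e\<close> as
  the ball of radius \<^term>\<open>r\<close> allows is near one of the ends. Iterates are on such segments, so
  one near the boundary of the ball can be followed back through the points that it was made of,
  until it is found to be close to an image \<^term>\<open>T s\<close> with \<^term>\<open>T s \<le> t\<close>. Then the displacement
  of \<^term>\<open>t\<close> is small enough for \<^term>\<open>T t\<close> to stay in the ball.
\<close>

lemma small_displacement_near_boundary:
  assumes \<alpha>_pos: "0 < \<alpha>" and r: "0 < r"
  shows "\<exists>d>0. d \<le> r / 12 \<and> (\<forall>m. \<forall>t\<in>pts (Suc (Suc m)).
    (\<forall>v\<in>C. x m \<le> v \<longrightarrow> dist (T v) e \<le> dist v e + d) \<longrightarrow>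
    (\<forall>v\<in>pts m \<union> pts (Suc m) \<union> {v \<in> pts (Suc (Suc m)). v < t}. dist v e \<le> r \<and> dist (T v) e \<le> r) \<longrightarrow>
    dist t e \<le> r \<longrightarrow> r - d < dist t e \<longrightarrow> D t \<le> 2 * dist t e)"
proof -
  define \<beta> where "\<beta> = max \<alpha> (1 - \<alpha>)"
  have \<beta>: "\<beta> < 1" using \<alpha>_pos \<alpha> by (simp add: \<beta>_def)
  (* Up to six errors E occur on the way back. With each step the distance from the boundary is at
     most doubled and increased by d, so it takes the values d, 3 d, 7 d, ..., 63 d. *)
  define E where "E = (1 - \<beta>) * r / (12 * (1 + K))"
  have E: "0 < E" "(2 + 2 * K) * (6 * E) = (1 - \<beta>) * r"
    using \<beta> r K_ge by (auto simp: E_def field_simps)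
  from extremal_near_endpoint[OF E(1), of r] obtain \<delta> where \<delta>: "0 < \<delta>"
    and ext: "\<forall>p u v t d. dist p u \<le> r \<longrightarrow> dist p v \<le> r \<longrightarrow> 0 \<le> t \<longrightarrow> t \<le> 1 \<longrightarrow> d \<le> \<delta> \<longrightarrow> r - d < dist p (H u v t) \<longrightarrow>
      (dist u (H u v t) \<le> E \<and> r - 2 * d < dist p u) \<or> (dist v (H u v t) \<le> E \<and> r - 2 * d < dist p v)"
    by blast
  define d where "d = min (\<delta> / 64) (min (r / 12) ((1 - \<beta>) * r / 3))"
  have d: "0 < d" "64 * d \<le> \<delta>" "d \<le> r / 12" "3 * d \<le> (1 - \<beta>) * r"
    using \<delta> r \<beta> by (auto simp: d_def)
  have small: "2 * \<beta> * r + d + (2 + 2 * K) * (6 * E) \<le> 2 * (r - d)"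
    using d(4) unfolding E(2) by (simp add: algebra_simps)
  have "D t \<le> 2 * dist t e"
    if grow: "\<forall>v\<in>C. x m \<le> v \<longrightarrow> dist (T v) e \<le> dist v e + d"
      and t: "t \<in> pts (Suc (Suc m))"
      and old: "\<forall>v\<in>pts m \<union> pts (Suc m) \<union> {v \<in> pts (Suc (Suc m)). v < t}. dist v e \<le> r \<and> dist (T v) e \<le> r"
      and tr: "dist t e \<le> r" "r - d < dist t e" for m t
  proof (rule ccontr)
    define n where "n = Suc (Suc m)"
    have tC: "t \<in> C" and xnt: "x n \<le> t" using t pts_C x_le_z x_le_y unfolding n_def by auto
    have xm: "x m \<le> x (Suc m)" "x (Suc m) \<le> x n" by (simp_all add: n_def x_mono)
    have Tt: "dist (T t) e \<le> r + d"
      using grow tC order_trans[OF xm(1) order_trans[OF xm(2) xnt]] tr(1) by force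
    assume "\<not> D t \<le> 2 * dist t e"
    then have "2 * (r - d) < D t" using tr(2) by simp
    then have bad: "2 * \<beta> * r + d + (2 + 2 * K) * (6 * E) < D t" by (rule le_less_trans[OF small])
    have anchor: "\<not> T s \<le> t" "dist s t \<le> \<epsilon>"
      if "s \<in> C" "s \<le> T s" "dist s e \<le> r" "s \<le> t" "dist (T s) t \<le> \<epsilon>" "\<epsilon> \<le> 6 * E" for s \<epsilon>
    proof -
      have "(2 + 2 * K) * \<epsilon> \<le> (2 + 2 * K) * (6 * E)" using that(6) K_ge by (intro mult_left_mono) auto
      then have b: "\<not> D t \<le> 2 * max \<alpha> (1 - \<alpha>) * r + d + (2 + 2 * K) * \<epsilon>" using bad unfolding \<beta>_def by (simp only: not_le le_less_trans[OF add_left_mono])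
      note * = displacement_near_image[OF that(1-3) tC that(4) tr(1) Tt that(5)]
      show "\<not> T s \<le> t" using *(1) b d(1) by force
      show "dist s t \<le> \<epsilon>" using *(2) b d(1) by force
    qed
    \<comment> \<open>One step back along a segment from \<open>u\<close> to its image: an end near the point is \<open>u\<close> itself,
      or it is the image, and then \<open>u\<close> is near too.\<close>
    have step_back: "dist u t \<le> \<epsilon> + E \<and> r - (2 * d' + d) < dist u e"
      if u: "u \<in> C" "u \<le> T u" "x m \<le> u" "u \<le> t" "dist u e \<le> r" "dist (T u) e \<le> r"
        and w: "w = H u (T u) \<tau>" "0 \<le> \<tau>" "\<tau> \<le> 1" "dist w t \<le> \<epsilon>" "r - d' < dist w e"
        and d': "d' \<le> \<delta>" and \<epsilon>: "\<epsilon> + E \<le> 6 * E" for u w \<tau> \<epsilon> d'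
    proof -
      have "(dist u w \<le> E \<and> r - 2 * d' < dist e u) \<or> (dist (T u) w \<le> E \<and> r - 2 * d' < dist e (T u))"
        using ext[rule_format, of e u "T u" \<tau> d'] u w d' by (simp add: dist_commute)
      then show ?thesis
      proof
        assume h: "dist u w \<le> E \<and> r - 2 * d' < dist e u"
        then show ?thesis using dist_triangle[of u t w] w(4) d(1) by (simp add: dist_commute)
      next
        assume h: "dist (T u) w \<le> E \<and> r - 2 * d' < dist e (T u)"
        then have "dist (T u) t \<le> \<epsilon> + E" using dist_triangle[of "T u" t w] w(4) by simp
        then have "dist u t \<le> \<epsilon> + E" using anchor(2) u \<epsilon> by blast
        moreover have "dist (T u) e \<le> dist u e + d" using grow u by blast
        ultimately show ?thesis using h by (simp add: dist_commute)
      qed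
    qed
    have old': "dist (x k) e \<le> r" "dist (z k) e \<le> r" "dist (y k) e \<le> r" "dist (T (x k)) e \<le> r" "dist (T (z k)) e \<le> r"
        "dist (T (y k)) e \<le> r"
      if "k = m \<or> k = Suc m" for k
      using that old by auto
    have xnear: "dist (x n) t \<le> 2 * E \<and> r - 7 * d < dist (x n) e"
    proof -
      have fromz: "dist (x n) t \<le> 2 * E \<and> r - 7 * d < dist (x n) e"
        if "z n \<le> t" "dist (z n) t \<le> E" "r - 3 * d < dist (z n) e" "dist (x n) e \<le> r" "dist (T (x n)) e \<le> r"
        using step_back[of "x n" "z n" "c n" E "3 * d"] that x_in[of n] xm xnt z_eq[of n] c01[of n] d E(1) 
        by (auto intro: order_trans)
      have "t = x n \<or> t = z n \<and> x n < t \<or> t = y n \<and> x n \<le> z n \<and> z n < t"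
        using t x_le_z[of n] z_le_y[of n] unfolding n_def[symmetric] by (auto simp: order.order_iff_strict)
      then have "t = x n \<or> t = z n \<and> dist (x n) e \<le> r \<and> dist (T (x n)) e \<le> r \<or>
          t = y n \<and> dist (x n) e \<le> r \<and> dist (T (x n)) e \<le> r \<and> dist (z n) e \<le> r \<and> dist (T (z n)) e \<le> r"
        using old le_less_trans[of "x n" "z n" t] unfolding n_def[symmetric] by blast
      then show ?thesis
      proof (elim disjE conjE)
        assume "t = x n" then show ?thesis using tr d E by simp
      next
        assume "t = z n" "dist (x n) e \<le> r" "dist (T (x n)) e \<le> r"
        then show ?thesis using fromz tr d E by simp
      next
        assume h: "t = y n" "dist (x n) e \<le> r" "dist (T (x n)) e \<le> r" "dist (z n) e \<le> r" "dist (T (z n)) e \<le> r"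
        have "x m \<le> z n" using xm x_le_z[of n] by (meson order_trans)
        moreover have zt: "z n \<le> t" using h(1) z_le_y by simp
        ultimately have "dist (z n) t \<le> 0 + E \<and> r - (2 * d + d) < dist (z n) e"
          by (rule step_back[OF pts_C(2) z_le_T _ _ h(4,5) trans[OF h(1) y_eq] b01])
            (use h(1) tr d E in auto)
        then show ?thesis using fromz h z_le_y by simp
      qed
    qed
    \<comment> \<open>The point \<open>x n\<close> is near the image of \<open>z\<close> or \<open>y\<close> one step back.\<close>
    have image: "\<exists>s\<in>{z k, y k}. dist (T s) w \<le> E \<and> r - 2 * d' < dist (T s) e"
      if "w = x (Suc k)" "k = m \<or> k = Suc m" "r - d' < dist w e" "d' \<le> \<delta>" for k w d'
      using ext[rule_format, of e "T (z k)" "T (y k)" "a k" d'] that old'[OF that(2)] a01[of k] x_Suc[of k]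
      by (auto simp: dist_commute)
    define k where "k = Suc m"
    have k: "k = m \<or> k = Suc m" "n = Suc k" "x k \<le> t" "x m \<le> x k"
      using xm xnt by (auto simp: k_def n_def intro: order_trans)
    have zk: "z k \<le> t" "y k \<le> t" using z_le_y[of k] y_le_x_Suc[of k] xnt unfolding k(2) by (meson order_trans)+
    have xmz: "x m \<le> z k" "x m \<le> y k" using k(4) x_le_z x_le_y by (meson order_trans)+
    obtain s where s: "s \<in> {z k, y k}" "dist (T s) (x n) \<le> E" "r - 14 * d < dist (T s) e"
      using image[of "x n" k "7 * d"] k xnear d by auto
    have "dist (T s) t \<le> 3 * E" using dist_triangle[of "T s" t "x n"] s(2) xnear by simp
    moreover have sC: "s \<in> C" "s \<le> T s" "dist s e \<le> r" "s \<le> t" "x m \<le> s"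
      using s(1) pts_C z_le_T y_le_T old'[OF k(1)] zk xmz by auto
    ultimately have st: "dist s t \<le> 3 * E" using anchor(2) E(1) by simp
    have sr: "r - 15 * d < dist s e" using grow sC s(3) by force
    have znear: "dist (z k) t \<le> 4 * E \<and> r - 31 * d < dist (z k) e"
    proof (cases "s = z k")
      case True then show ?thesis using st sr d E by simp
    next
      case False
      then have "s = y k" using s(1) by simp
      then show ?thesis
        using step_back[of "z k" s "b k" "3 * E" "15 * d"] st sr d E pts_C z_le_T zk xmz old'[OF k(1)] y_eq[of k] b01[of k]
        by simp
    qed
    have xknear: "dist (x k) t \<le> 5 * E \<and> r - 63 * d < dist (x k) e"
      using step_back[of "x k" "z k" "c k" "4 * E" "31 * d"] znear d E x_in[of k] k(3,4) old'[OF k(1)] z_eq[of k] c01[of k]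
      by simp
    obtain s' where s': "s' \<in> {z m, y m}" "dist (T s') (x k) \<le> E"
      using image[of "x k" m "63 * d"] xknear d by (auto simp: k_def)
    have "dist (T s') t \<le> 6 * E" using dist_triangle[of "T s'" t "x k"] s'(2) xknear by simp
    moreover have "T s' \<le> t" using s'(1) Tz_le_x[of m] Ty_le_x[of m] xnt unfolding n_def by (auto intro: order_trans)
    moreover have "s' \<in> C" "s' \<le> T s'" "dist s' e \<le> r"
      using s'(1) pts_C z_le_T y_le_T old'[of m] by auto
    ultimately show False using anchor(1)[of s' "6 * E"] order_trans[of s' "T s'" t] by blast
  qed
  then show ?thesis using d(1,3) by (intro exI[of _ d] conjI allI ballI impI) assumption+
qed

text \<open>
  Images increase the distance to \<^term>\<open>e\<close> by an arbitrarily small amount only, so points well inside the ball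
  stay in it. Points near the boundary have small displacement, so they are not bad for \<^term>\<open>e\<close>, and
  their images are no farther from \<^term>\<open>e\<close>.
\<close>

lemma trapping:
  assumes \<alpha>_pos: "0 < \<alpha>" and r: "0 < r"
  shows "\<exists>N. \<forall>n\<ge>N. dist (x n) e \<le> r"
proof -
  from small_displacement_near_boundary[OF \<alpha>_pos r] obtain d where d: "0 < d" "d \<le> r / 12" and boundary:
    "\<forall>m. \<forall>t\<in>pts (Suc (Suc m)). (\<forall>v\<in>C. x m \<le> v \<longrightarrow> dist (T v) e \<le> dist v e + d) \<longrightarrow>
      (\<forall>v\<in>pts m \<union> pts (Suc m) \<union> {v \<in> pts (Suc (Suc m)). v < t}. dist v e \<le> r \<and> dist (T v) e \<le> r) \<longrightarrow>
      dist t e \<le> r \<longrightarrow> r - d < dist t e \<longrightarrow> D t \<le> 2 * dist t e"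
    by (elim exE conjE) (rule that)
  obtain N where N: "\<forall>n\<ge>N. \<forall>v\<in>C. x n \<le> v \<longrightarrow> dist (T v) e \<le> dist v e + d"
    using growth_bound[OF d(1)] by blast
  have "0 < r / 2" using r by simp
  then obtain n0 where n0: "n0 \<ge> N" "dist (x n0) e \<le> r / 2" using x_near_e by blast
  define inside where "inside n \<longleftrightarrow> (\<forall>v\<in>pts n. dist v e \<le> r \<and> dist (T v) e \<le> r)" for n
  have grow: "dist (T v) e \<le> dist v e + d" if "n \<ge> N" "v \<in> pts n" for n v
    using N that pts_facts[OF that(2)] by blast
  \<comment> \<open>The first two steps do not leave the ball, because each of the six images adds at most \<open>d\<close>.\<close>
  have start: "inside n \<and> dist (x (Suc n)) e \<le> \<rho> + 3 * d"
    if n: "n \<ge> N" "dist (x n) e \<le> \<rho>" "\<rho> + 3 * d \<le> r" for n \<rho>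
  proof -
    have g: "dist (T (x n)) e \<le> dist (x n) e + d" "dist (T (z n)) e \<le> dist (z n) e + d" "dist (T (y n)) e \<le> dist (y n) e + d"
      using grow[OF n(1)] by auto
    have z: "dist (z n) e \<le> \<rho> + d"
      using dist_H_ball[OF c01, of e "x n" "\<rho> + d" "T (x n)" n] g n d by (simp add: z_eq dist_commute)
    have y: "dist (y n) e \<le> \<rho> + 2 * d"
      using dist_H_ball[OF b01, of e "z n" "\<rho> + 2 * d" "T (z n)" n] g z d by (simp add: y_eq[of n] dist_commute)
    have "dist (x (Suc n)) e \<le> \<rho> + 3 * d"
      using dist_H_ball[OF a01, of e "T (z n)" "\<rho> + 3 * d" "T (y n)" n] g z y d by (simp add: x_Suc dist_commute)
    then show ?thesis using g n y z d by (auto simp: inside_def)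
  qed
  have step: "inside (Suc (Suc m)) \<and> dist (x (Suc (Suc (Suc m)))) e \<le> r"
    if m: "m \<ge> N" "inside m" "inside (Suc m)" "dist (x (Suc (Suc m))) e \<le> r" for m
  proof -
    define n where "n = Suc (Suc m)"
    have T: "dist (T t) e \<le> r" if t: "t \<in> pts n" "dist t e \<le> r"
      and below: "\<forall>v\<in>pts n. v < t \<longrightarrow> dist v e \<le> r \<and> dist (T v) e \<le> r" for t
    proof (cases "r - d < dist t e")
      case True
      have "D t \<le> 2 * dist t e"
        using t below m(2,3) N m(1) True unfolding n_def inside_def by (intro boundary[rule_format, of t m]) auto
      then have "dist (T t) e \<le> dist t e" using pts_facts[OF t(1)] e by (intro quasi_nonexpansive) auto
      then show ?thesis using t(2) by simp
    next
      case False
      then show ?thesis using grow[of n t] t(1) m(1) by (simp add: n_def)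
    qed
    have x: "dist (x n) e \<le> r" using m(4) by (simp add: n_def)
    have Tx: "dist (T (x n)) e \<le> r" using T[of "x n"] x leD[OF x_le_z[of n]] leD[OF x_le_y[of n]] by auto
    have z: "dist (z n) e \<le> r"
      using dist_H_ball[OF c01, of e "x n" r "T (x n)" n] x Tx by (simp add: z_eq dist_commute)
    have Tz: "dist (T (z n)) e \<le> r" using T[of "z n"] x Tx z leD[OF z_le_y[of n]] by auto
    have y: "dist (y n) e \<le> r"
      using dist_H_ball[OF b01, of e "z n" r "T (z n)" n] z Tz by (simp add: y_eq[of n] dist_commute)
    have Ty: "dist (T (y n)) e \<le> r" using T[of "y n"] x Tx z Tz y by auto
    have "dist (x (Suc n)) e \<le> r"
      using dist_H_ball[OF a01, of e "T (z n)" r "T (y n)" n] Tz Ty by (simp add: x_Suc dist_commute)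
    then show ?thesis using x Tx z Tz y Ty by (simp add: n_def[symmetric] inside_def)
  qed
  have "inside (n0 + k) \<and> inside (Suc (n0 + k)) \<and> dist (x (Suc (Suc (n0 + k)))) e \<le> r" for k
  proof (induction k)
    case 0
    have "inside n0 \<and> dist (x (Suc n0)) e \<le> r / 2 + 3 * d" using n0 d by (intro start) auto
    moreover from this have "inside (Suc n0) \<and> dist (x (Suc (Suc n0))) e \<le> (r / 2 + 3 * d) + 3 * d"
      using n0 d by (intro start) auto
    ultimately show ?case using d by auto
  next
    case (Suc k) then show ?case using step[of "n0 + k"] n0(1) by simp
  qed
  then have "dist (x (n0 + k)) e \<le> r" for k unfolding inside_def by blast
  then show ?thesis by (metis le_add_diff_inverse)
qed

section \<open>Bad points for \<open>\<alpha> = 0\<close>\<close>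

text \<open>
  The iterates come arbitrarily close to \<^term>\<open>e\<close>, so \<^term>\<open>e\<close> is the only point of \<^term>\<open>{..e}\<close> above all of them.
  Hence it is the only common point of the decreasing convex sets of points between \<^term>\<open>x N\<close>
  and \<^term>\<open>e\<close>, and a closed ball that meets all these sets contains it.
\<close>

lemma dist_e_le_of_late_points:
  assumes "\<And>N. \<exists>u\<in>C. x N \<le> u \<and> u \<le> e \<and> dist w u \<le> \<theta>"
  shows "dist w e \<le> \<theta>"
proof -
  define A where "A n = C \<inter> {x n..} \<inter> {..e}" for n
  have conv: "hconvex H (A n)" for n
    using C_convex up_convex[of "x n"] down_convex[of e] unfolding A_def hconvex_def by blast
  have closed: "closed (A n)" for n unfolding A_def by (intro closed_Int C_closed up_closed down_closed)
  have dec: "A (Suc n) \<subseteq> A n" for n using x_mono[of n "Suc n"] by (auto simp: A_def intro: order_trans)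
  have meets: "\<exists>u\<in>A n. dist w u \<le> \<theta>" for n using assms[of n] by (auto simp: A_def)
  obtain q where q: "\<And>n. q \<in> A n" "dist w q \<le> \<theta>"
    using nested_convex_Int_nonempty[of A w \<theta>, OF complete_space_UNIV closed conv dec meets] by blast
  have "e \<in> closure {..q}" unfolding closure_approachable
  proof (intro allI impI)
    fix \<eta> :: real assume \<eta>: "0 < \<eta>"
    then obtain n where "dist (x n) e \<le> \<eta> / 2" using x_near_e[of "\<eta> / 2"] by auto
    then show "\<exists>v\<in>{..q}. dist v e < \<eta>" using \<eta> q(1)[of n] by (intro bexI[of _ "x n"]) (auto simp: A_def)
  qed
  then have "e \<le> q" using down_closed[of q] by simp
  then have "q = e" using q(1)[of 0] by (auto simp: A_def)
  then show ?thesis using q(2) by simp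
qed

text \<open>
  Points between \<^term>\<open>x N\<close> and \<^term>\<open>e\<close> for large \<^term>\<open>N\<close> are called late. If late points \<open>u\<close> were outside
  of the ball, there would be some on its boundary. For \<^prop>\<open>\<alpha> = 0\<close> their images, which are late too, are
  within \<^term>\<open>D v / 2\<close> of \<^term>\<open>T v\<close>, and so is \<^term>\<open>e\<close> by the previous lemma. But \<^term>\<open>v\<close> is at
  distance less than \<^term>\<open>D v / 2\<close> from \<^term>\<open>e\<close>.
\<close>

lemma late_points_near_bad_point:
  assumes \<alpha>_0: "\<alpha> = 0" and v: "v \<in> pts k" "2 * dist v e < D v"
  shows "\<exists>N. \<forall>u\<in>C. x N \<le> u \<longrightarrow> u \<le> e \<longrightarrow> dist v u < D v / 2"
proof (rule ccontr)
  assume far: "\<not> ?thesis"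
  note vC = pts_facts[OF v(1)]
  have "dist (T v) e \<le> D v / 2"
  proof (rule dist_e_le_of_late_points)
    fix N
    obtain u where u: "u \<in> C" "x (max N (Suc (Suc k))) \<le> u" "u \<le> e" "D v / 2 \<le> dist v u"
      using far by (meson not_le)
    have "dist v e < D v / 2" using v(2) by simp
    from segment_point_at_dist[OF this u(4)] obtain s
      where s: "0 \<le> s" "s \<le> 1" "dist v (H e u s) = D v / 2" by blast
    define w where "w = H e u s"
    have ue: "x (max N (Suc (Suc k))) \<le> e" using below_fixed e by blast
    have w: "w \<in> C" "x (max N (Suc (Suc k))) \<le> w" "w \<le> e"
      using H_mem[OF e_C u(1) s(1,2)] H_ge[OF ue u(2) s(1,2)] H_le[OF order_refl u(3) s(1,2)] by (auto simp: w_def)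
    have Nw: "x N \<le> w" "v \<le> w"
      using w(2) x_mono[of N "max N (Suc (Suc k))"] x_mono[of "Suc (Suc k)" "max N (Suc (Suc k))"] vC(2,4)
      by (meson max.cobounded1 max.cobounded2 order_trans)+
    have "dist (T v) (T w) \<le> dist v w"
      using nonexp[OF vC(1) w(1) Nw(2)] s(3) \<alpha>_0 by (simp add: w_def)
    then have "dist (T v) (T w) \<le> D v / 2" using s(3) by (simp add: w_def)
    moreover have "x N \<le> T w" using x_in[of N] T_mono[OF pts_C(1) w(1) Nw(1)] by (meson order_trans)
    moreover have "T w \<le> e" using T_mono[OF w(1) e_C w(3)] T_e by simp
    ultimately show "\<exists>u\<in>C. x N \<le> u \<and> u \<le> e \<and> dist (T v) u \<le> D v / 2" using T_mem[OF w(1)] by blast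
  qed
  moreover have "D v \<le> dist v e + dist (T v) e" by (rule dist_triangle2)
  ultimately show False using v(2) by simp
qed

text \<open>
  Let \<^term>\<open>v\<close> be a bad point whose displacement is nearly minimal among bad points. A late bad
  point \<open>v'\<close> and its image are both within \<open>D v / 2\<close> of \<^term>\<open>v\<close>, so \<^term>\<open>v\<close> is
  close to their midpoint. The midpoints are late points, hence \<^term>\<open>v\<close> is close to \<^term>\<open>e\<close>. The same
  is true of \<open>v'\<close>. But then \<open>v'\<close> is close to the midpoint, and its displacement is small.
\<close>

lemma bad_point_with_small_displacement:
  assumes \<alpha>_0: "\<alpha> = 0" and bad: "\<And>N. \<exists>n\<ge>N. \<exists>v\<in>pts n. 2 * dist v e < D v" and \<epsilon>: "0 < \<epsilon>"
  shows "\<exists>n. \<exists>v\<in>pts n. 2 * dist v e < D v \<and> D v < \<epsilon>"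
proof -
  define B where "B = {v. \<exists>n. v \<in> pts n \<and> 2 * dist v e < D v}"
  define d where "d = Inf (D ` B)"
  define \<zeta> where "\<zeta> = \<epsilon> / 7"
  have \<zeta>: "0 < \<zeta>" using \<epsilon> by (simp add: \<zeta>_def)
  have "B \<noteq> {}" using bad by (fastforce simp: B_def)
  moreover have bdd: "bdd_below (D ` B)" by (rule bdd_belowI2[of _ 0]) simp
  ultimately have near_inf: "\<exists>v\<in>B. D v < d + \<eta>" if "0 < \<eta>" for \<eta>
    using cInf_less_iff[of "D ` B" "d + \<eta>"] that by (auto simp: d_def)
  have d_le: "d \<le> D v" if "v \<in> B" for v using cInf_lower[OF imageI[OF that] bdd] by (simp add: d_def)
  from geodesic_nearly_unique[OF \<zeta>, of "d + 1"] obtain \<delta> where \<delta>: "0 < \<delta>"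
    and unique: "\<forall>(u::'a) v p q s t. s \<le> d + 1 \<longrightarrow> dist u p \<le> s \<longrightarrow> dist u q \<le> s \<longrightarrow> dist v p \<le> t \<longrightarrow>
           dist v q \<le> t \<longrightarrow> s + t \<le> dist u v + \<delta> \<longrightarrow> dist p q < \<zeta>" by blast
  define mid where "mid v = H v (T v) (1/2)" for v
  have mid: "dist v (mid v) = D v / 2" "dist (T v) (mid v) = D v / 2" for v
    using dist_H_left(1)[of "1/2" v "T v"] dist_H_left(2)[of "1/2" "T v" v] by (simp_all add: mid_def)
  have late: "\<exists>N. \<forall>n\<ge>N. \<forall>v'\<in>pts n. 2 * dist v' e < D v' \<longrightarrow> dist v (mid v') < \<zeta> \<and> D v' \<le> D v"
    if v: "v \<in> B" "D v < d + min \<delta> 1" for v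
  proof -
    obtain N where N: "\<forall>u\<in>C. x N \<le> u \<longrightarrow> u \<le> e \<longrightarrow> dist v u < D v / 2"
      using v(1) late_points_near_bad_point[OF \<alpha>_0] unfolding B_def by blast
    have "dist v (mid v') < \<zeta> \<and> D v' \<le> D v" if v': "n \<ge> N" "v' \<in> pts n" "2 * dist v' e < D v'" for n v'
    proof -
      note f = pts_facts[OF v'(2)]
      have xv: "x N \<le> v'" "x N \<le> T v'" using x_mono[OF v'(1)] f(2,3) by (meson order_trans)+
      have near: "dist v v' < D v / 2" "dist v (T v') < D v / 2"
        using N f(1,5,6) xv T_mem[OF f(1)] e by blast+
      then have le: "D v' \<le> D v" using dist_triangle3[of v' "T v'" v] by linarith
      have "v' \<in> B" using v' by (auto simp: B_def)
      then have "d \<le> D v'" by (rule d_le)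
      then have "D v / 2 + D v / 2 \<le> D v' + \<delta>" using v(2) by simp
      moreover have "D v / 2 \<le> d + 1" using v(2) zero_le_dist[of v "T v"] by linarith
      ultimately have "dist v (mid v') < \<zeta>"
        using unique[rule_format, of "D v / 2" v' v "mid v'" "T v'" "D v / 2"] near mid[of v'] le
        by (simp add: dist_commute)
      then show ?thesis using le by blast
    qed
    then show ?thesis by blast
  qed
  have near_e: "dist v e \<le> \<zeta>" if v: "v \<in> B" "D v < d + min \<delta> 1" for v
  proof (rule dist_e_le_of_late_points)
    fix N
    obtain M where M: "\<forall>n\<ge>M. \<forall>v'\<in>pts n. 2 * dist v' e < D v' \<longrightarrow> dist v (mid v') < \<zeta> \<and> D v' \<le> D v"
      using late[OF v] by blast
    obtain n v' where v': "n \<ge> max N M" "v' \<in> pts n" "2 * dist v' e < D v'" using bad by blast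
    note f = pts_facts[OF v'(2)]
    have xv: "x N \<le> v'" "x N \<le> T v'" using x_mono[of N n] v'(1) f(2,3) by (meson order_trans max.boundedE)+
    have half: "(0::real) \<le> 1 / 2" "(1::real) / 2 \<le> 1" by simp_all
    have "mid v' \<in> C" unfolding mid_def by (rule H_mem[OF f(1) T_mem[OF f(1)] half])
    moreover have "x N \<le> mid v'" unfolding mid_def by (rule H_ge[OF xv half])
    moreover have "mid v' \<le> e" unfolding mid_def by (rule H_le[OF f(5,6)[OF e] half])
    moreover have "dist v (mid v') \<le> \<zeta>" using M v' by force
    ultimately show "\<exists>u\<in>C. x N \<le> u \<and> u \<le> e \<and> dist v u \<le> \<zeta>" by blast
  qed
  obtain v where v: "v \<in> B" "D v < d + min \<delta> 1" using near_inf[of "min \<delta> 1"] \<delta> by auto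
  obtain N where N: "\<forall>n\<ge>N. \<forall>v'\<in>pts n. 2 * dist v' e < D v' \<longrightarrow> dist v (mid v') < \<zeta> \<and> D v' \<le> D v"
    using late[OF v] by blast
  obtain n v' where v': "n \<ge> N" "v' \<in> pts n" "2 * dist v' e < D v'" using bad by blast
  have le: "dist v (mid v') < \<zeta>" "D v' \<le> D v" using N v' by blast+
  have "v' \<in> B" using v' by (auto simp: B_def)
  then have "dist v' e \<le> \<zeta>" using le(2) v(2) by (intro near_e) auto
  moreover have "dist v e \<le> \<zeta>" by (rule near_e[OF v])
  moreover have "dist v' (mid v') \<le> dist v v' + dist v (mid v')" by (rule dist_triangle3)
  moreover have "dist v v' \<le> dist v e + dist v' e" by (rule dist_triangle2)
  ultimately have "D v' \<le> 6 * \<zeta>" using le(1) mid(1)[of v'] by linarith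
  then have "D v' < \<epsilon>" using \<zeta> by (simp add: \<zeta>_def)
  then show ?thesis using v' by blast
qed

text \<open>
  If bad points occur again and again, there are some with small displacement, and both \<^term>\<open>e\<close> and all
  late points are close to them. Otherwise the distances to \<^term>\<open>e\<close> eventually decrease.
\<close>

lemma convergence_if_alpha_0:
  assumes \<alpha>_0: "\<alpha> = 0"
  shows "x \<longlonglongrightarrow> e"
proof (rule x_tendsto_e)
  fix \<eta> :: real assume \<eta>: "0 < \<eta>"
  show "\<exists>N. \<forall>n\<ge>N. dist (x n) e \<le> \<eta>"
  proof (cases "\<forall>N. \<exists>n\<ge>N. \<exists>v\<in>pts n. 2 * dist v e < D v")
    case True
    then obtain k v where v: "v \<in> pts k" "2 * dist v e < D v" "D v < \<eta>"
      using bad_point_with_small_displacement[OF \<alpha>_0 _ \<eta>] by blast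
    obtain N where N: "\<forall>u\<in>C. x N \<le> u \<longrightarrow> u \<le> e \<longrightarrow> dist v u < D v / 2"
      using late_points_near_bad_point[OF \<alpha>_0 v(1,2)] by blast
    have "dist (x n) e \<le> \<eta>" if "n \<ge> N" for n
    proof -
      have "dist v (x n) < D v / 2" using N pts_C(1) x_mono[OF that] below_fixed(1)[OF e] by blast
      then show ?thesis using v(2,3) dist_triangle3[of "x n" e v] by linarith
    qed
    then show ?thesis by blast
  next
    case False
    then obtain N where good: "\<And>n v. N \<le> n \<Longrightarrow> v \<in> pts n \<Longrightarrow> D v \<le> 2 * dist v e" by (meson not_le)
    obtain m where m: "m \<ge> N" "dist (x m) e \<le> \<eta>" using x_near_e[OF \<eta>] by blast
    have "dist (x n) e \<le> \<eta>" if "n \<ge> m" for n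
      using dist_antimono_if_good[OF e good m(1) that] m(2) by (rule order_trans)
    then show ?thesis by blast
  qed
qed

end

context increasing_iteration
begin

text \<open>
  Either the iteration is eventually free of bad points and hence quasi-nonexpansive, or there is a bad
  point, which confines the iterates that are close to fixed points to a bounded set.
\<close>

theorem convergence_from_below:
  assumes near: "\<And>\<eta> N. 0 < \<eta> \<Longrightarrow> \<exists>n\<ge>N. \<exists>p\<in>F. dist (x n) p < \<eta>"
  shows "\<exists>q\<in>F. x \<longlonglongrightarrow> q"
proof (cases "\<exists>N. \<forall>n\<ge>N. \<forall>v\<in>pts n. \<forall>p\<in>F. D v \<le> 2 * dist v p")
  case True
  then obtain N where N: "\<forall>n\<ge>N. \<forall>v\<in>pts n. \<forall>p\<in>F. D v \<le> 2 * dist v p" by blast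
  show ?thesis by (rule convergence_if_good[OF near]) (use N in blast)+
next
  case False
  then obtain k v p where v: "v \<in> pts k" and p: "p \<in> F" and bad: "2 * dist v p < D v" by (meson not_le order_refl)
  obtain R where R: "\<forall>\<eta>>0. \<forall>N. \<exists>n\<ge>N. \<exists>q\<in>F. dist (x n) q < \<eta> \<and> dist (x n) p \<le> R"
    using near_fixed_points_bounded[OF near pts_facts(1,2,4)[OF v] p bad] by blast
  have "\<exists>n\<ge>N. \<exists>q\<in>F. dist (x n) q \<le> \<eta> \<and> D (x n) \<le> \<eta>" if "0 < \<eta>" for \<eta> N
    by (rule small_displacement_subsequence[OF _ p that]) (use R in blast)
  then obtain e where e: "e \<in> F"
    "\<And>\<eta> N. 0 < \<eta> \<Longrightarrow> \<exists>n\<ge>N. dist (x n) e \<le> \<eta>"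
    "\<And>\<eta>. 0 < \<eta> \<Longrightarrow> \<exists>N. \<forall>n\<ge>N. \<exists>l\<in>C. l \<le> T l \<and> T l \<le> x n \<and> dist l e \<le> \<eta> \<and> D l \<le> \<eta>"
    using approach_to_least_fixed_point by blast
  interpret approaching_iteration H C T \<alpha> a b c x y z e by unfold_locales (use e in blast)+
  have "x \<longlonglongrightarrow> e"
  proof (cases "\<alpha> = 0")
    case True then show ?thesis by (rule convergence_if_alpha_0)
  next
    case False
    then have "0 < \<alpha>" using \<alpha> by simp
    then show ?thesis using trapping by (intro x_tendsto_e) blast
  qed
  then show ?thesis using e(1) by blast
qed

end

section \<open>The iteration from above\<close>

context monotone_nonexpansive_map
begin

text \<open>
  Above a fixed point the premise of the defining inequality is trivial, since the smaller point has
  displacement zero.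
\<close>

lemma quasi_nonexpansive_above:
  assumes "p \<in> F" "u \<in> C" "p \<le> u"
  shows "p \<le> T u" "dist p (T u) \<le> dist p u"
proof -
  have p: "p \<in> C" "T p = p" using F_D assms(1) by auto
  show "p \<le> T u" using T_mono[OF p(1) assms(2,3)] p(2) by simp
  have "(1 - \<alpha>) * dist p (T u) \<le> (1 - \<alpha>) * dist p u"
    using nonexp[OF p(1) assms(2,3)] p(2) by (simp add: algebra_simps)
  then show "dist p (T u) \<le> dist p u" using \<alpha> by simp
qed

text \<open>
  All points stay above all fixed points. So their distances to the fixed points decrease,
  closeness to one fixed point persists, and the iterates form a Cauchy sequence.
\<close>

lemma convergence_from_above:
  fixes a b c :: "nat \<Rightarrow> real" and x y z :: "nat \<Rightarrow> 'a"
  assumes a01: "\<And>n. 0 \<le> a n" "\<And>n. a n \<le> 1" and b01: "\<And>n. 0 \<le> b n" "\<And>n. b n \<le> 1"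
    and c01: "\<And>n. 0 \<le> c n" "\<And>n. c n \<le> 1"
    and z_eq: "\<And>n. z n = H (x n) (T (x n)) (c n)"
    and y_eq: "\<And>n. y n = H (z n) (T (z n)) (b n)"
    and x_Suc: "\<And>n. x (Suc n) = H (T (z n)) (T (y n)) (a n)"
    and x0: "x 0 \<in> C" "\<And>p. p \<in> F \<Longrightarrow> p \<le> x 0"
    and near: "\<And>\<eta> N. 0 < \<eta> \<Longrightarrow> \<exists>n\<ge>N. \<exists>p\<in>F. dist (x n) p < \<eta>"
  shows "\<exists>q\<in>F. x \<longlonglongrightarrow> q"
proof -
  have mem: "z n \<in> C \<and> y n \<in> C \<and> x (Suc n) \<in> C" if "x n \<in> C" for n
    unfolding x_Suc y_eq[of n] z_eq using that a01 b01 c01 by (intro conjI H_mem T_mem) auto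
  have xC: "x n \<in> C" for n by (induction n) (use x0 mem in auto)
  then have zC: "z n \<in> C" and yC: "y n \<in> C" for n using mem by blast+
  have step: "p \<le> x (Suc n) \<and> dist p (x (Suc n)) \<le> dist p (x n)" if p: "p \<in> F" "p \<le> x n" for p n
  proof -
    note Tx = quasi_nonexpansive_above[OF p(1) xC p(2)]
    have z: "p \<le> z n" "dist p (z n) \<le> dist p (x n)"
      unfolding z_eq using H_ge[OF p(2) Tx(1) c01] dist_H_ball[OF c01 order_refl Tx(2)] by auto
    note Tz = quasi_nonexpansive_above[OF p(1) zC z(1)]
    have y: "p \<le> y n" "dist p (y n) \<le> dist p (x n)"
      unfolding y_eq[of n] using H_ge[OF z(1) Tz(1) b01] dist_H_ball[OF b01 z(2)] Tz(2) z(2) by auto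
    note Ty = quasi_nonexpansive_above[OF p(1) yC y(1)]
    show ?thesis
      unfolding x_Suc using H_ge[OF Tz(1) Ty(1) a01] dist_H_ball[OF a01] Tz(2) Ty(2) z(2) y(2)
      by (meson order_trans)
  qed
  have above: "p \<le> x n" if "p \<in> F" for p n
    by (induction n) (use x0(2) that step in auto)
  have anti: "dist p (x n) \<le> dist p (x m)" if "p \<in> F" "m \<le> n" for p m n
    using lift_Suc_antimono_le[of "\<lambda>n. dist p (x n)" m n] step above that by blast
  have "Cauchy x"
  proof (rule metric_CauchyI)
    fix \<eta> :: real assume "0 < \<eta>"
    then obtain m p where m: "p \<in> F" "dist (x m) p < \<eta> / 2" using near[of "\<eta> / 2"] by force
    have "dist (x i) (x j) < \<eta>" if "i \<ge> m" "j \<ge> m" for i j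
      using anti[OF m(1) that(1)] anti[OF m(1) that(2)] m(2) dist_triangle3[of "x i" "x j" p]
      by (simp add: dist_commute)
    then show "\<exists>M. \<forall>i\<ge>M. \<forall>j\<ge>M. dist (x i) (x j) < \<eta>" by blast
  qed
  then obtain q where q: "x \<longlonglongrightarrow> q" using Cauchy_convergent convergent_def by blast
  have qC: "q \<in> C" using closed_sequentially[OF C_closed _ q] xC by blast
  have "D q \<le> \<epsilon>" if \<epsilon>: "0 < \<epsilon>" for \<epsilon>
  proof -
    have half: "0 < \<epsilon> / 4" using \<epsilon> by simp
    obtain M where M: "\<And>n. n \<ge> M \<Longrightarrow> dist (x n) q < \<epsilon> / 4" using q half unfolding lim_sequentially by blast
    obtain n p where n: "n \<ge> M" "p \<in> F" "dist (x n) p < \<epsilon> / 4" using near[OF half] by blast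
    have "p \<le> q" using q above[OF n(2)] by (rule limit_ge)
    then have "dist p (T q) \<le> dist p q" using quasi_nonexpansive_above n(2) qC by blast
    moreover have "dist p q \<le> dist (x n) p + dist (x n) q" by (rule dist_triangle3)
    moreover have "D q \<le> dist p q + dist p (T q)" by (rule dist_triangle3)
    ultimately show ?thesis using M[OF n(1)] n(3) by linarith
  qed
  then have "D q \<le> 0" by (rule field_le_epsilon[of _ 0, simplified])
  then have "q \<in> F" using qC by (simp add: fixed_points_def)
  then show ?thesis using q by blast
qed

end

section \<open>The convergence criterion\<close>

lemma infdist_tendsto_0_if_convergent:
  assumes "p \<in> S" "x \<longlonglongrightarrow> p"
  shows "(\<lambda>n. infdist (x n) S) \<longlonglongrightarrow> 0"
proof (rule tendsto_sandwich[of "\<lambda>_. 0" _ _ "\<lambda>n. dist (x n) p"])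
  show "(\<lambda>n. dist (x n) p) \<longlonglongrightarrow> 0" using assms(2) tendsto_dist_iff by blast
qed (use assms(1) in \<open>auto simp: infdist_nonneg infdist_le\<close>)

lemma frequently_near_if_liminf_infdist_0:
  assumes "S \<noteq> {}" "liminf (\<lambda>n. ereal (infdist (x n) S)) = 0" "0 < \<eta>"
  shows "\<exists>n\<ge>N. \<exists>p\<in>S. dist (x n) p < \<eta>"
proof (rule ccontr)
  assume far: "\<not> ?thesis"
  have "\<eta> \<le> infdist (x n) S" if "n \<ge> N" for n
    unfolding infdist_notempty[OF assms(1)] using far that assms(1) by (intro cINF_greatest) (auto simp: not_less)
  then have "eventually (\<lambda>n. ereal \<eta> \<le> ereal (infdist (x n) S)) sequentially"
    unfolding eventually_sequentially by auto
  then have "ereal \<eta> \<le> liminf (\<lambda>n. ereal (infdist (x n) S))" by (rule Liminf_bounded)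
  then show False using assms(2,3) by simp
qed

theorem theorem4:
  fixes H :: "'a::{complete_space,order} \<Rightarrow> 'a \<Rightarrow> real \<Rightarrow> 'a"
    and C :: "'a set"
    and T :: "'a \<Rightarrow> 'a"
    and a b c :: "nat \<Rightarrow> real"
    and x y z :: "nat \<Rightarrow> 'a"
  assumes "po_hyperbolic_space H"
    and "uniformly_convex H"
    and "monotone_modulus H"
    and "C \<noteq> {}" and "closed C" and "hconvex H C"
    and "T \<in> C \<rightarrow> C"
    and "monotone_gen_alpha_nonexpansive C T"
    and "\<And>n. n \<ge> 1 \<Longrightarrow> a n \<in> {0<..<1}"
    and "\<And>n. n \<ge> 1 \<Longrightarrow> b n \<in> {0<..<1}"
    and "\<And>n. n \<ge> 1 \<Longrightarrow> c n \<in> {0<..<1}"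
    and "x 1 \<in> C"
    and "\<And>n. n \<ge> 1 \<Longrightarrow> z n = H (x n) (T (x n)) (c n)"
    and "\<And>n. n \<ge> 1 \<Longrightarrow> y n = H (z n) (T (z n)) (b n)"
    and "\<And>n. n \<ge> 1 \<Longrightarrow> x (Suc n) = H (T (z n)) (T (y n)) (a n)"
    and "fixed_points C T \<noteq> {}"
    and "(x 1 \<le> T (x 1) \<and> (\<forall>p\<in>fixed_points C T. x 1 \<le> p)) \<or>
         (T (x 1) \<le> x 1 \<and> (\<forall>p\<in>fixed_points C T. p \<le> x 1))"
  shows "(\<exists>p\<in>fixed_points C T. x \<longlonglongrightarrow> p) \<longleftrightarrow>
         liminf (\<lambda>n. ereal (infdist (x n) (fixed_points C T))) = 0"
proof
  assume "\<exists>p\<in>fixed_points C T. x \<longlonglongrightarrow> p"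
  then have "(\<lambda>n. infdist (x n) (fixed_points C T)) \<longlonglongrightarrow> 0"
    using infdist_tendsto_0_if_convergent by blast
  then have "(\<lambda>n. ereal (infdist (x n) (fixed_points C T))) \<longlonglongrightarrow> 0"
    by (simp add: zero_ereal_def)
  then show "liminf (\<lambda>n. ereal (infdist (x n) (fixed_points C T))) = 0"
    by (intro lim_imp_Liminf) auto
next
  assume lim: "liminf (\<lambda>n. ereal (infdist (x n) (fixed_points C T))) = 0"
  obtain \<alpha> where \<alpha>: "0 \<le> \<alpha>" "\<alpha> < 1" and nonexp: "\<forall>x\<in>C. \<forall>y\<in>C. x \<le> y \<longrightarrow> (1 / 2) * dist x (T x) \<le> dist x y \<longrightarrow>
      dist (T x) (T y) \<le> \<alpha> * dist (T x) y + \<alpha> * dist x (T y) + (1 - 2 * \<alpha>) * dist x y"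
    using assms(8) unfolding monotone_gen_alpha_nonexpansive_def by blast
  have T_mono: "T u \<le> T v" if "u \<in> C" "v \<in> C" "u \<le> v" for u v
    using assms(8) that unfolding monotone_gen_alpha_nonexpansive_def mono_on_def by blast
  interpret monotone_nonexpansive_map H C T \<alpha>
  proof
    show "hyperbolic_space H" "closed {u..}" "hconvex H {u..}" "closed {..u}" "hconvex H {..u}" for u
      using assms(1) unfolding po_hyperbolic_space_def by auto
    show "dist (T u) (T v) \<le> \<alpha> * dist (T u) v + \<alpha> * dist u (T v) + (1 - 2 * \<alpha>) * dist u v"
      if "u \<in> C" "v \<in> C" "u \<le> v" "dist u (T u) \<le> 2 * dist u v" for u v
      using nonexp that by simp
  qed (use assms(2,3,5-7) \<alpha> T_mono in auto)
  define X where "X n = x (Suc n)" for n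
  have near: "\<exists>n\<ge>N. \<exists>p\<in>F. dist (X n) p < \<eta>" if "0 < \<eta>" for \<eta> N
  proof -
    from frequently_near_if_liminf_infdist_0[OF assms(16) lim that]
    obtain n p where "n \<ge> Suc N" "p \<in> F" "dist (x n) p < \<eta>" by blast
    then show ?thesis by (intro exI[of _ "n - 1"]) (auto simp: X_def)
  qed
  have par: "0 \<le> a (Suc n)" "a (Suc n) \<le> 1" "0 \<le> b (Suc n)" "b (Suc n) \<le> 1" "0 \<le> c (Suc n)" "c (Suc n) \<le> 1" for n
    using assms(9-11)[of "Suc n"] by auto
  have eqs: "z (Suc n) = H (X n) (T (X n)) (c (Suc n))" "y (Suc n) = H (z (Suc n)) (T (z (Suc n))) (b (Suc n))"
    "X (Suc n) = H (T (z (Suc n))) (T (y (Suc n))) (a (Suc n))" for n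
    using assms(13-15)[of "Suc n"] by (auto simp: X_def)
  have X0: "X 0 = x 1" by (simp add: X_def)
  have "\<exists>q\<in>F. X \<longlonglongrightarrow> q"
    using assms(17)
  proof
    assume "x 1 \<le> T (x 1) \<and> (\<forall>p\<in>F. x 1 \<le> p)"
    then interpret increasing_iteration H C T \<alpha> "\<lambda>n. a (Suc n)" "\<lambda>n. b (Suc n)" "\<lambda>n. c (Suc n)"
      X "\<lambda>n. y (Suc n)" "\<lambda>n. z (Suc n)"
      by unfold_locales (use par eqs X0 assms(12,16) in auto)
    show ?thesis by (rule convergence_from_below[OF near])
  next
    assume "T (x 1) \<le> x 1 \<and> (\<forall>p\<in>F. p \<le> x 1)"
    then have "X 0 \<in> C" "\<And>p. p \<in> F \<Longrightarrow> p \<le> X 0" using X0 assms(12) by auto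
    then show ?thesis by (rule convergence_from_above[OF par eqs _ _ near])
  qed
  then show "\<exists>p\<in>fixed_points C T. x \<longlonglongrightarrow> p" unfolding X_def filterlim_sequentially_Suc .
qed

end
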